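(* There exists an absolute constant $C>0$ with the following property, and in fact the property holds for $C=0.000024$. Let $f\colon\mathbb{D}\to\mathbb{C}$ be holomorphic and $0<r<1$. Suppose that all zeros of $f$ are in the interval $[0,r]$ while all $1$-points of $f$ are in the interval $[-r,0]$. Suppose also that $f$ assumes both values $0$ and $1$ at least once, and assumes one of these values at least twice (counting multiplicities). Then $r\geq C$.
   Context: $\mathbb{D}=\{z\in\mathbb{C}: |z|<1\}$. A $1$-point of $f$ is a point $z\in\mathbb{D}$ with $f(z)=1$. *)

theory Defs
  imports "HOL-Complex_Analysis.Complex_Analysis"
begin

text \<open>
  The number of \<open>a\<close>-points of \<open>f\<close> in \<open>S\<close>, counted with multiplicity, is at least \<open>n\<close>.
  The total is the supremum of its finite partial sums, so infinitely many \<open>a\<close>-points count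
  as arbitrarily many (a plain \<open>sum\<close> over an infinite set would be \<open>0\<close>).
  Pitfall: \<open>zorder (\<lambda>w. f w - a) z\<close> is the multiplicity only if \<open>f\<close> is holomorphic near \<open>z\<close>
  and not locally constant there; on a connected open \<open>S\<close> this holds as soon as a holomorphic
  \<open>f\<close> takes two different values.
\<close>
definition takes_value_at_least ::
    "nat \<Rightarrow> (complex \<Rightarrow> complex) \<Rightarrow> complex set \<Rightarrow> complex \<Rightarrow> bool" where
  "takes_value_at_least n f S a \<longleftrightarrow>
     (\<exists>A. finite A \<and> A \<subseteq> {z \<in> S. f z = a} \<and> int n \<le> (\<Sum>z\<in>A. zorder (\<lambda>w. f w - a) z))"

definition radius_bound :: "real \<Rightarrow> bool" where
  "radius_bound C \<longleftrightarrow>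
     (\<forall>(f :: complex \<Rightarrow> complex) (r :: real).
        f holomorphic_on ball 0 1 \<longrightarrow> 0 < r \<longrightarrow> r < 1 \<longrightarrow>
        {z \<in> ball 0 1. f z = 0} \<subseteq> complex_of_real ` {0..r} \<longrightarrow>
        {z \<in> ball 0 1. f z = 1} \<subseteq> complex_of_real ` {-r..0} \<longrightarrow>
        (\<exists>z \<in> ball 0 1. f z = 0) \<longrightarrow> (\<exists>z \<in> ball 0 1. f z = 1) \<longrightarrow>
        takes_value_at_least 2 f (ball 0 1) 0 \<or> takes_value_at_least 2 f (ball 0 1) 1 \<longrightarrow>
        C \<le> r)"

end

theory Submission
  imports Defs
begin

text \<open>
  Suppose \<open>r\<close> is tiny and \<open>f\<close> has zeros \<open>a\<close> (multiplicity \<open>m a\<close>) in \<open>[0,r]\<close>, at least two with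
  multiplicity, and \<open>1\<close>-points \<open>b\<close> (multiplicity \<open>l b\<close>) in \<open>[-r,0]\<close>; the other case follows by passing
  to \<open>1 - f (- z)\<close>. For a polynomial of degree at least \<open>2\<close>, comparing second coefficients gives
  \<open>(\<Sum>a. m a * a) = (\<Sum>b. l b * b)\<close>, which is impossible because the left side is \<open>\<ge> 0\<close>, the right side is
  \<open>\<le> 0\<close>, and not all terms vanish. In general the difference of the two sides is
  \<open>1 / (2 * pi * \<i>)\<close> times the integral of \<open>Ln (1 - 1 / f z)\<close> over a small circle enclosing \<open>[-r,r]\<close> on which \<open>\<bar>f\<bar> > 1\<close>,
  so it suffices that \<open>1 / f\<close> is small there.

  The annulus \<open>r < \<bar>z\<bar> < 1\<close> is so wide that a Schottky estimate for functions omitting \<open>0\<close> and \<open>1\<close> applies: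
  if \<open>\<bar>f\<bar> \<le> 1\<close> somewhere on the circle \<open>\<bar>z\<bar> = exp (- 7/2)\<close>, then \<open>\<bar>f\<bar> \<le> exp 12\<close> on all of it. Dividing out
  the zeros, the maximum principle would then force \<open>\<bar>f\<bar> < 1\<close> at a \<open>1\<close>-point. Hence \<open>\<bar>f\<bar> > 1\<close> on that circle, and
  Harnack's inequality for the logarithm of the zero-free part of \<open>f\<close> makes \<open>\<bar>f\<bar>\<close> large on a smaller circle.

  The Schottky estimate uses Landau's device of writing \<open>ln f = pi * \<i> * (1 + cos P)\<close>, where \<open>P\<close> omits a net of
  points, and an Ahlfors-type metric with the sharp half-plane singularity at each point of the net.
\<close>

section \<open>Derivatives of functions omitting a net\<close>

text \<open>The hypothesis makes the hyperbolic derivative of \<open>\<psi>\<close> largest at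
  \<open>0\<close>. If \<open>\<psi>\<close> had derivative of norm above \<open>1\<close> there,
  then \<open>norm (\<psi> w) > norm w\<close> for small \<open>w \<noteq> 0\<close>, so the
  hypothesis would give \<open>deriv \<psi>\<close> a strict local maximum of its norm at
  \<open>0\<close>, against the maximum modulus principle. This replaces the curvature computation
  in Ahlfors' lemma.\<close>

lemma Schwarz_local:
  assumes hol: "\<psi> holomorphic_on ball 0 e" and e: "0 < e" and \<psi>0: "\<psi> 0 = 0"
    and le: "\<And>w. w \<in> ball 0 e \<Longrightarrow>
      (1 - (norm w)\<^sup>2) * norm (deriv \<psi> w) \<le> (1 - (norm (\<psi> w))\<^sup>2) * norm (deriv \<psi> 0)"
  shows "norm (deriv \<psi> 0) \<le> 1"
proof (rule ccontr)
  assume "\<not> norm (deriv \<psi> 0) \<le> 1"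
  then have c: "norm (deriv \<psi> 0) > 1" by simp
  obtain g where holg: "g holomorphic_on ball 0 e"
    and gw: "\<And>z. norm z < e \<Longrightarrow> \<psi> z = z * g z" and g0: "deriv \<psi> 0 = g 0"
    using Schwarz3 [OF hol \<psi>0] by metis
  have "continuous_on (ball 0 e) (\<lambda>z. norm (g z))"
    by (intro continuous_intros holomorphic_on_imp_continuous_on holg)
  then have "continuous (at 0) (\<lambda>z. norm (g z))"
    using e by (simp add: continuous_on_eq_continuous_at)
  then have "((\<lambda>z. norm (g z)) \<longlongrightarrow> norm (g 0)) (nhds 0)"
    by (metis isCont_def tendsto_at_iff_tendsto_nhds)
  then have "eventually (\<lambda>z. 1 < norm (g z)) (nhds 0)"
    using c g0 order_tendstoD(1) by fastforce
  then obtain d where d: "d > 0" "\<And>z. norm z < d \<Longrightarrow> 1 < norm (g z)"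
    by (auto simp: eventually_nhds_metric)
  define r where "r = Min {d, e, 1}"
  have r: "0 < r" "r \<le> d" "r \<le> e" "r \<le> 1" using d e by (auto simp: r_def)
  have strict: "norm (deriv \<psi> w) < norm (deriv \<psi> 0)" if w: "norm w < r" "w \<noteq> 0" for w
  proof -
    have "norm (\<psi> w) = norm w * norm (g w)"
      using gw[of w] w r by (simp add: norm_mult)
    moreover have "norm w * 1 < norm w * norm (g w)"
      using d(2)[of w] w r by (intro mult_strict_left_mono) auto
    ultimately have "norm w < norm (\<psi> w)" by simp
    then have "(norm w)\<^sup>2 < (norm (\<psi> w))\<^sup>2" by (simp add: power_strict_mono)
    then have "(1 - (norm (\<psi> w))\<^sup>2) * norm (deriv \<psi> 0) < (1 - (norm w)\<^sup>2) * norm (deriv \<psi> 0)"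
      using c by (intro mult_strict_right_mono) auto
    then have "(1 - (norm w)\<^sup>2) * norm (deriv \<psi> w) < (1 - (norm w)\<^sup>2) * norm (deriv \<psi> 0)"
      using le[of w] w r by auto
    moreover have "0 < 1 - (norm w)\<^sup>2" using w r by (simp add: abs_square_less_1)
    ultimately show ?thesis by (simp add: mult_less_cancel_left_pos)
  qed
  have "deriv \<psi> constant_on ball 0 r"
  proof (rule maximum_modulus_principle[where U = "ball 0 r" and \<xi> = 0])
    show "deriv \<psi> holomorphic_on ball 0 r"
      using holomorphic_deriv[OF hol open_ball] r by (rule_tac holomorphic_on_subset) auto
  qed (use r strict in \<open>force+\<close>)
  moreover have "(of_real (r/2) :: complex) \<in> ball 0 r" "(0::complex) \<in> ball 0 r"
    using r by auto
  ultimately have "deriv \<psi> (of_real (r/2)) = deriv \<psi> 0"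
    unfolding constant_on_def by metis
  moreover have "norm (deriv \<psi> (of_real (r/2))) < norm (deriv \<psi> 0)"
    using r by (intro strict) auto
  ultimately show False by simp
qed

text \<open>The Cayley transform \<open>\<psi>\<close> sends the left half-plane to the disc and
  \<open>h 0\<close> to \<open>0\<close>. It is an isometry of the hyperbolic metrics, so the
  inequality for \<open>h\<close> becomes the hypothesis of \<open>Schwarz_local\<close> for
  \<open>\<psi>\<close>.\<close>

lemma half_plane_local_Schwarz:
  assumes hol: "h holomorphic_on ball 0 e" and e: "0 < e"
    and neg: "\<And>w. w \<in> ball 0 e \<Longrightarrow> Re (h w) < 0"
    and le: "\<And>w. w \<in> ball 0 e \<Longrightarrow>
      (1 - (norm w)\<^sup>2) * (norm (deriv h w) / - Re (h w)) \<le> norm (deriv h 0) / - Re (h 0)"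
  shows "norm (deriv h 0) \<le> 2 * - Re (h 0)"
proof -
  define H where "H w = h w + cnj (h 0)" for w
  define \<psi> where "\<psi> w = (h w - h 0) / H w" for w
  have 0: "(0::complex) \<in> ball 0 e" using e by auto
  have nz: "H w \<noteq> 0" if "w \<in> ball 0 e" for w
  proof -
    have "Re (H w) < 0" unfolding H_def using neg[OF that] neg[OF 0] by simp
    then show ?thesis by auto
  qed
  have d\<psi>: "(\<psi> has_field_derivative deriv h w * (2 * Re (h 0)) / (H w)\<^sup>2) (at w)"
    if w: "w \<in> ball 0 e" for w
  proof -
    have dh: "(h has_field_derivative deriv h w) (at w)"
      using hol w by (meson holomorphic_derivI open_ball)
    have "(\<psi> has_field_derivative
        (deriv h w * H w - (h w - h 0) * deriv h w) / (H w * H w)) (at w)"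
      unfolding \<psi>_def[abs_def] using nz[OF w] unfolding H_def
      by (auto intro!: derivative_eq_intros dh)
    moreover have "deriv h w * H w - (h w - h 0) * deriv h w = deriv h w * (2 * Re (h 0))"
    proof -
      have "deriv h w * H w - (h w - h 0) * deriv h w = deriv h w * (h 0 + cnj (h 0))"
        unfolding H_def by (simp add: algebra_simps)
      then show ?thesis by (simp add: complex_add_cnj)
    qed
    ultimately show ?thesis by (simp add: power2_eq_square)
  qed
  have nd: "norm (deriv \<psi> w) = norm (deriv h w) * (2 * - Re (h 0)) / (norm (H w))\<^sup>2"
    if w: "w \<in> ball 0 e" for w
    using DERIV_imp_deriv[OF d\<psi>[OF w]] neg[OF 0]
    by (simp add: norm_mult norm_divide norm_power)
  have n1: "1 - (norm (\<psi> w))\<^sup>2 = 4 * Re (h w) * Re (h 0) / (norm (H w))\<^sup>2"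
    if w: "w \<in> ball 0 e" for w
  proof -
    have "(norm (H w))\<^sup>2 - (norm (h w - h 0))\<^sup>2 = 4 * Re (h w) * Re (h 0)"
      unfolding H_def cmod_power2 by (simp add: power2_eq_square algebra_simps)
    moreover have "(norm (\<psi> w))\<^sup>2 = (norm (h w - h 0))\<^sup>2 / (norm (H w))\<^sup>2"
      by (simp add: \<psi>_def norm_divide power_divide)
    moreover have "(norm (H w))\<^sup>2 \<noteq> 0" using nz[OF w] by simp
    ultimately show ?thesis by (simp add: diff_divide_distrib[symmetric] field_simps)
  qed
  have "norm (deriv \<psi> 0) \<le> 1"
  proof (rule Schwarz_local[OF _ e])
    show "\<psi> holomorphic_on ball 0 e"
      unfolding holomorphic_on_open[OF open_ball] using d\<psi> by blast
    show "\<psi> 0 = 0" by (simp add: \<psi>_def)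
    fix w :: complex assume w: "w \<in> ball 0 e"
    have H0: "(norm (H 0))\<^sup>2 = 4 * (Re (h 0))\<^sup>2"
      unfolding H_def by (simp add: complex_add_cnj norm_mult power_mult_distrib)
    have pos: "0 < (norm (H w))\<^sup>2" using nz[OF w] by simp
    have a: "0 < - Re (h w)" "0 < - Re (h 0)" using neg[OF w] neg[OF 0] by auto
    have "(1 - (norm w)\<^sup>2) * norm (deriv h w) * (- Re (h 0)) \<le> norm (deriv h 0) * - Re (h w)"
      using le[OF w] a by (simp add: field_simps)
    then have "((1 - (norm w)\<^sup>2) * norm (deriv h w) * (- Re (h 0))) * (2 / (norm (H w))\<^sup>2)
        \<le> (norm (deriv h 0) * - Re (h w)) * (2 / (norm (H w))\<^sup>2)"
      using pos by (intro mult_right_mono) auto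
    also have "\<dots> = (1 - (norm (\<psi> w))\<^sup>2) * norm (deriv \<psi> 0)"
      unfolding n1[OF w] nd[OF 0] H0 using a pos by (simp add: field_simps power2_eq_square)
    finally have "((1 - (norm w)\<^sup>2) * norm (deriv h w) * (- Re (h 0))) * (2 / (norm (H w))\<^sup>2)
        \<le> (1 - (norm (\<psi> w))\<^sup>2) * norm (deriv \<psi> 0)" .
    moreover have "(1 - (norm w)\<^sup>2) * norm (deriv \<psi> w)
        = ((1 - (norm w)\<^sup>2) * norm (deriv h w) * (- Re (h 0))) * (2 / (norm (H w))\<^sup>2)"
      unfolding nd[OF w] by (simp add: mult_ac)
    ultimately show "(1 - (norm w)\<^sup>2) * norm (deriv \<psi> w) \<le> (1 - (norm (\<psi> w))\<^sup>2) * norm (deriv \<psi> 0)"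
      by simp
  qed
  then have "norm (deriv h 0) * (2 * - Re (h 0)) \<le> (norm (H 0))\<^sup>2"
    unfolding nd[OF 0] using nz[OF 0] by (simp add: field_simps)
  also have "\<dots> = (2 * - Re (h 0)) * (2 * - Re (h 0))"
    unfolding H_def by (simp add: complex_add_cnj norm_mult power_mult_distrib) (simp add: power2_eq_square)
  finally have "norm (deriv h 0) * (2 * - Re (h 0)) \<le> (2 * - Re (h 0)) * (2 * - Re (h 0))" .
  then show ?thesis
    by (rule mult_right_le_imp_le) (use neg[OF 0] in simp)
qed

text \<open>As a function of \<open>x\<close>, the left side has derivative
  \<open>ln (\<delta> / x)\<close>, which is nonnegative up to \<open>x = \<delta>\<close> thanks to
  the factor \<open>exp 1\<close>. The proof uses only \<open>ln t \<le> t - 1\<close>.\<close>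

lemma mult_ln_mono:
  fixes x y :: real
  assumes "0 < x" "x \<le> y" "y \<le> \<delta>"
  shows "x * ln (exp 1 * \<delta> / x) \<le> y * ln (exp 1 * \<delta> / y)"
proof -
  have "ln (y / x) \<le> y / x - 1" using assms by (intro ln_le_minus_one) auto
  then have 1: "x * ln (y / x) \<le> (y - x) * 1" using assms by (simp add: field_simps)
  have "ln (exp 1) \<le> ln (exp 1 * \<delta> / y)" using assms by (simp add: field_simps ln_div ln_mult)
  then have 2: "(y - x) * 1 \<le> (y - x) * ln (exp 1 * \<delta> / y)"
    using assms by (intro mult_left_mono) auto
  have "x * ln (exp 1 * \<delta> / x) = x * ln (exp 1 * \<delta> / y) + x * ln (y / x)"
    using assms by (simp add: ln_div ln_mult algebra_simps)
  with 1 2 show ?thesis by (simp add: algebra_simps)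
qed

lemma disc_automorphism_identity:
  fixes z w :: complex
  assumes "1 + cnj z * w \<noteq> 0"
  shows "1 - (norm ((w + z) / (1 + cnj z * w)))\<^sup>2
    = (1 - (norm z)\<^sup>2) * (1 - (norm w)\<^sup>2) / (norm (1 + cnj z * w))\<^sup>2"
proof -
  have "(norm (1 + cnj z * w))\<^sup>2 - (norm (w + z))\<^sup>2 = (1 - (norm z)\<^sup>2) * (1 - (norm w)\<^sup>2)"
    unfolding cmod_power2 by (simp add: power2_eq_square algebra_simps)
  moreover have "(norm ((w + z) / (1 + cnj z * w)))\<^sup>2 = (norm (w + z))\<^sup>2 / (norm (1 + cnj z * w))\<^sup>2"
    by (simp add: norm_divide power_divide)
  moreover have "(norm (1 + cnj z * w))\<^sup>2 \<noteq> 0" using assms by simp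
  ultimately show ?thesis by (simp add: nonzero_eq_divide_eq left_diff_distrib)
qed

lemma isCont_eventually_less:
  fixes f :: "'a :: t2_space \<Rightarrow> real"
  assumes "isCont f a" "f a < c"
  shows "eventually (\<lambda>x. f x < c) (nhds a)"
  using assms by (metis isCont_def tendsto_at_iff_tendsto_nhds order_tendstoD(2))

text \<open>
  Ahlfors' argument for the metric with density \<open>1 / (d * ln (e * \<delta> / d))\<close>, where \<open>d\<close> is the distance to \<open>\<Gamma>\<close>. Since
  \<open>x * ln (e * \<delta> / x)\<close> increases for \<open>x \<le> \<delta>\<close>, replacing \<open>d\<close> by the distance to one fixed point \<open>\<gamma>\<close> of \<open>\<Gamma>\<close> only
  decreases the density, and the resulting metric is the pullback of the half-plane metric under a logarithm.
\<close>

lemma omitted_net_deriv_bound_aux: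
  assumes hol: "P holomorphic_on ball 0 R" and R: "1 < R"
    and cl: "closed \<Gamma>" and net: "\<And>X::complex. \<exists>\<gamma>\<in>\<Gamma>. dist X \<gamma> < \<delta>"
    and om: "\<And>z. z \<in> ball 0 R \<Longrightarrow> P z \<notin> \<Gamma>"
  shows "norm (deriv P 0) \<le> 2 * \<delta>"
proof -
  have ne: "\<Gamma> \<noteq> {}" using net by blast
  have \<delta>: "0 < \<delta>" using net[of 0] by (meson le_less_trans zero_le_dist)
  define D where "D z = infdist (P z) \<Gamma>" for z
  define u where "u z = (1 - (norm z)\<^sup>2) * norm (deriv P z) / (D z * ln (exp 1 * \<delta> / D z))" for z
  have Dlt: "D z < \<delta>" for z
    using net[of "P z"] infdist_le by (metis D_def le_less_trans)
  have Dpos: "0 < D z" if "z \<in> ball 0 R" for z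
    using in_closed_iff_infdist_zero[OF cl ne, of "P z"] om[OF that] infdist_nonneg[of "P z" \<Gamma>]
    by (simp add: D_def order_less_le)
  have lnge: "1 \<le> ln (exp 1 * \<delta> / x)" if "0 < x" "x \<le> \<delta>" for x
  proof -
    have "ln (exp 1) \<le> ln (exp 1 * \<delta> / x)" using that \<delta> by (subst ln_le_cancel_iff) (auto simp: field_simps)
    then show ?thesis by simp
  qed
  have holP': "deriv P holomorphic_on ball 0 R"
    by (intro holomorphic_deriv hol) auto
  have sub: "cball 0 1 \<subseteq> ball (0::complex) R" using R by auto
  \<comment> \<open>Since \<open>R > 1\<close>, the function \<open>u\<close> is defined and
    continuous up to the unit circle, where the factor \<open>1 - (norm z)\<^sup>2\<close> makes it
    vanish. A positive maximum is therefore attained inside the disc.\<close>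
  have "continuous_on (cball 0 1) u"
    unfolding u_def D_def
    by (intro continuous_intros holomorphic_on_imp_continuous_on
        holomorphic_on_subset[OF holP' sub] holomorphic_on_subset[OF hol sub])
      (use Dpos[unfolded D_def] sub lnge[OF Dpos less_imp_le[OF Dlt], unfolded D_def] \<delta> in \<open>force+\<close>)
  then obtain z0 where z0: "z0 \<in> cball 0 1" and max: "\<And>z. z \<in> cball 0 1 \<Longrightarrow> u z \<le> u z0"
    using continuous_attains_sup[of "cball 0 1" u] by auto
  have u0: "norm (deriv P 0) \<le> u 0 * \<delta>"
  proof -
    have D0: "0 < D 0" using R by (intro Dpos) auto
    have "D 0 * ln (exp 1 * \<delta> / D 0) \<le> \<delta> * ln (exp 1 * \<delta> / \<delta>)"
      by (rule mult_ln_mono) (use D0 Dlt less_imp_le in auto)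
    then have le: "D 0 * ln (exp 1 * \<delta> / D 0) \<le> \<delta>" using \<delta> by simp
    have "1 \<le> ln (exp 1 * \<delta> / D 0)" by (intro lnge D0 less_imp_le Dlt)
    then have "0 < D 0 * ln (exp 1 * \<delta> / D 0)" using D0 by auto
    then have "norm (deriv P 0) = u 0 * (D 0 * ln (exp 1 * \<delta> / D 0))"
      using D0 \<open>1 \<le> ln (exp 1 * \<delta> / D 0)\<close> unfolding u_def by auto
    also have "\<dots> \<le> u 0 * \<delta>"
      using le \<open>0 < D 0 * ln (exp 1 * \<delta> / D 0)\<close> by (intro mult_left_mono) (auto simp: u_def)
    finally show ?thesis .
  qed
  have "u z0 \<le> 2"
  proof (cases "u z0 \<le> 0")
    case False
    then have "norm z0 \<noteq> 1" by (auto simp: u_def)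
    with z0 have z01: "norm z0 < 1" by simp
    have den: "1 + cnj z0 * w \<noteq> 0" if "norm w < 1" for w
    proof
      assume "1 + cnj z0 * w = 0"
      then have "norm (cnj z0 * w) = 1" by (metis add_eq_0_iff norm_minus_cancel norm_one)
      moreover have "norm z0 * norm w \<le> 1 * norm w" using z01 by (intro mult_right_mono) auto
      ultimately show False using that by (simp add: norm_mult)
    qed
    \<comment> \<open>This disc automorphism moves the maximum point \<open>z0\<close> to the
      origin. By invariance of the hyperbolic metric, \<open>u (\<phi> w)\<close> has the same form
      as \<open>u\<close>, with \<open>Q\<close> in place of \<open>P\<close>.\<close>
    define \<phi> where "\<phi> w = (w + z0) / (1 + cnj z0 * w)" for w
    have q: "1 - (norm (\<phi> w))\<^sup>2 = (1 - (norm z0)\<^sup>2) * (1 - (norm w)\<^sup>2) / (norm (1 + cnj z0 * w))\<^sup>2"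
      if "norm w < 1" for w
      unfolding \<phi>_def by (rule disc_automorphism_identity[OF den[OF that]])
    have sq: "0 < 1 - (norm z)\<^sup>2" if "norm z < 1" for z :: complex
      using that by (simp add: abs_square_less_1)
    have \<phi>1: "norm (\<phi> w) < 1" if "norm w < 1" for w
    proof -
      have "0 < 1 - (norm (\<phi> w))\<^sup>2" unfolding q[OF that] using sq[OF z01] sq[OF that] den[OF that] by simp
      then show ?thesis by (simp add: abs_square_less_1)
    qed
    define c where "c = 1 - (norm z0)\<^sup>2"
    have c: "0 < c" unfolding c_def by (rule sq[OF z01])
    have d\<phi>: "(\<phi> has_field_derivative of_real c / (1 + cnj z0 * w)\<^sup>2) (at w)"
      if "norm w < 1" for w
    proof -
      have "(\<phi> has_field_derivative
          ((1 + cnj z0 * w) - (w + z0) * cnj z0) / ((1 + cnj z0 * w) * (1 + cnj z0 * w))) (at w)"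
        unfolding \<phi>_def[abs_def] using den[OF that] by (auto intro!: derivative_eq_intros)
      moreover have "(1 + cnj z0 * w) - (w + z0) * cnj z0 = of_real c"
        unfolding c_def using complex_norm_square[of z0] by (simp add: ring_distribs mult.commute)
      ultimately show ?thesis by (simp add: power2_eq_square)
    qed
    define Q where "Q w = P (\<phi> w)" for w
    have \<phi>R: "\<phi> w \<in> ball 0 R" if "norm w < 1" for w using \<phi>1[OF that] R by auto
    have dQ: "(Q has_field_derivative deriv P (\<phi> w) * (of_real c / (1 + cnj z0 * w)\<^sup>2)) (at w)"
      if "norm w < 1" for w
      unfolding Q_def[abs_def]
      by (rule DERIV_chain2[OF holomorphic_derivI[OF hol open_ball \<phi>R[OF that]] d\<phi>[OF that]])
    have uQ: "u (\<phi> w) = (1 - (norm w)\<^sup>2) * norm (deriv Q w) / (D (\<phi> w) * ln (exp 1 * \<delta> / D (\<phi> w)))"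
      if "norm w < 1" for w
    proof -
      have "norm (deriv Q w) = norm (deriv P (\<phi> w)) * c / (norm (1 + cnj z0 * w))\<^sup>2"
        using DERIV_imp_deriv[OF dQ[OF that]] c by (simp add: norm_mult norm_divide norm_power)
      then show ?thesis unfolding u_def q[OF that] c_def by simp
    qed
    have \<phi>0: "\<phi> 0 = z0" by (simp add: \<phi>_def)
    \<comment> \<open>A point of \<open>\<Gamma>\<close> nearest to \<open>Q 0\<close>: the
      comparison metric built from \<open>\<gamma>\<close> alone agrees with the original one at
      \<open>0\<close> and lies below it nearby, so its maximum is still at
      \<open>0\<close>.\<close>
    obtain \<gamma> where \<gamma>: "\<gamma> \<in> \<Gamma>" "infdist (Q 0) \<Gamma> = dist (Q 0) \<gamma>"
      using infdist_attains_inf[OF cl ne] by metis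
    have D0: "D (\<phi> 0) = norm (Q 0 - \<gamma>)" using \<gamma> by (simp add: D_def Q_def dist_norm)
    have Q0: "0 < norm (Q 0 - \<gamma>)" "norm (Q 0 - \<gamma>) < \<delta>"
      using Dpos[OF \<phi>R[of 0]] Dlt[of "\<phi> 0"] unfolding D0 by auto
    have contQ: "isCont Q 0" using dQ[of 0] by (auto intro: DERIV_isCont)
    have cont: "isCont (\<lambda>w. norm (Q w - \<gamma>)) 0" "isCont (\<lambda>w. norm ((Q w - \<gamma>) / (Q 0 - \<gamma>) - 1)) 0"
      using contQ Q0 by (auto intro!: continuous_intros)
    have "eventually (\<lambda>w. norm (Q w - \<gamma>) < \<delta>) (nhds 0)"
      "eventually (\<lambda>w. norm ((Q w - \<gamma>) / (Q 0 - \<gamma>) - 1) < 1) (nhds 0)"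
      by (rule isCont_eventually_less[OF cont(1)], use Q0 in simp, rule isCont_eventually_less[OF cont(2)], use Q0 in simp)
    then have "eventually (\<lambda>w. norm (Q w - \<gamma>) < \<delta> \<and> norm ((Q w - \<gamma>) / (Q 0 - \<gamma>) - 1) < 1) (nhds 0)"
      by (rule eventually_conj)
    then obtain e' where e': "e' > 0"
      "\<And>w. norm w < e' \<Longrightarrow> norm (Q w - \<gamma>) < \<delta>"
      "\<And>w. norm w < e' \<Longrightarrow> norm ((Q w - \<gamma>) / (Q 0 - \<gamma>) - 1) < 1"
      unfolding eventually_nhds_metric by auto
    define e where "e = min e' 1"
    have e: "0 < e" "e \<le> e'" "e \<le> 1" using e' by (auto simp: e_def)
    have nz: "Q w \<noteq> \<gamma>" if "norm w < 1" for w
      using om[OF \<phi>R[OF that]] \<gamma> by (auto simp: Q_def)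
    \<comment> \<open>Up to an imaginary constant, \<open>h\<close> is the logarithm of
      \<open>(Q w - \<gamma>) / (exp 1 * \<delta>)\<close>. Dividing by
      \<open>Q 0 - \<gamma>\<close> keeps the argument of \<open>Ln\<close> within distance
      \<open>1\<close> of \<open>1\<close>, hence off the branch cut.\<close>
    define h where "h w = Ln ((Q w - \<gamma>) / (Q 0 - \<gamma>)) + of_real (ln (norm (Q 0 - \<gamma>) / (exp 1 * \<delta>)))" for w
    have Re: "Re (h w) = - ln (exp 1 * \<delta> / norm (Q w - \<gamma>))" if "w \<in> ball 0 e" for w
    proof -
      have "Q w - \<gamma> \<noteq> 0" using nz[of w] e that by auto
      then show ?thesis
        unfolding h_def using Q0 \<delta> by (simp add: ln_div ln_mult norm_divide)
    qed
    have dh: "(h has_field_derivative deriv Q w / (Q w - \<gamma>)) (at w)" if w: "w \<in> ball 0 e" for w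
    proof -
      have dQ': "(Q has_field_derivative deriv Q w) (at w)"
        using dQ[of w] w e by (auto simp: DERIV_imp_deriv)
      have "0 < Re ((Q w - \<gamma>) / (Q 0 - \<gamma>))"
        using e'(3)[of w] w e abs_Re_le_cmod[of "(Q w - \<gamma>) / (Q 0 - \<gamma>) - 1"] by auto
      then have "(Q w - \<gamma>) / (Q 0 - \<gamma>) \<notin> \<real>\<^sub>\<le>\<^sub>0"
        using complex_nonpos_Reals_iff by force
      then have "((\<lambda>w. Ln ((Q w - \<gamma>) / (Q 0 - \<gamma>))) has_field_derivative
          inverse ((Q w - \<gamma>) / (Q 0 - \<gamma>)) * (deriv Q w / (Q 0 - \<gamma>))) (at w)"
        using DERIV_diff[OF dQ' DERIV_const[of \<gamma>], THEN DERIV_cdivide, of "Q 0 - \<gamma>"]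
        by (intro DERIV_chain2[OF has_field_derivative_Ln]) auto
      moreover have "inverse ((Q w - \<gamma>) / (Q 0 - \<gamma>)) * (deriv Q w / (Q 0 - \<gamma>)) = deriv Q w / (Q w - \<gamma>)"
        using Q0 by (simp add: divide_inverse)
      ultimately show ?thesis
        unfolding h_def[abs_def] using DERIV_add[OF _ DERIV_const] by fastforce
    qed
    have "norm (deriv h 0) \<le> 2 * - Re (h 0)"
    proof (rule half_plane_local_Schwarz[OF _ e(1)])
      show "h holomorphic_on ball 0 e" unfolding holomorphic_on_open[OF open_ball] using dh by blast
      show "Re (h w) < 0" if "w \<in> ball 0 e" for w
        unfolding Re[OF that] using lnge[of "norm (Q w - \<gamma>)"] nz[of w] e'(2)[of w] e that by fastforce
      fix w :: complex assume w: "w \<in> ball 0 e"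
      have w1: "norm w < 1" using w e by auto
      have "(1 - (norm w)\<^sup>2) * (norm (deriv h w) / - Re (h w))
          = (1 - (norm w)\<^sup>2) * norm (deriv Q w) / (norm (Q w - \<gamma>) * ln (exp 1 * \<delta> / norm (Q w - \<gamma>)))"
        unfolding Re[OF w] DERIV_imp_deriv[OF dh[OF w]] by (simp add: norm_divide)
      also have "\<dots> \<le> u (\<phi> w)"
      proof -
        have "D (\<phi> w) \<le> norm (Q w - \<gamma>)"
          unfolding D_def Q_def using \<gamma> by (simp add: infdist_le flip: dist_norm)
        then have "D (\<phi> w) * ln (exp 1 * \<delta> / D (\<phi> w))
            \<le> norm (Q w - \<gamma>) * ln (exp 1 * \<delta> / norm (Q w - \<gamma>))"
          using Dpos[OF \<phi>R[OF w1]] e'(2)[of w] w e by (intro mult_ln_mono) auto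
        moreover have "1 \<le> ln (exp 1 * \<delta> / D (\<phi> w))" using Dpos[OF \<phi>R[OF w1]] Dlt[of "\<phi> w"] by (intro lnge) auto
        moreover have "0 < D (\<phi> w) * ln (exp 1 * \<delta> / D (\<phi> w))"
          using calculation Dpos[OF \<phi>R[OF w1]] by (intro mult_pos_pos) auto
        ultimately show ?thesis
          unfolding uQ[OF w1] using sq[OF w1]
          by (intro frac_le mult_nonneg_nonneg) auto
      qed
      also have "\<dots> \<le> u (\<phi> 0)" using max[of "\<phi> w"] \<phi>1[OF w1] by (simp add: \<phi>0)
      also have "\<dots> = norm (deriv h 0) / - Re (h 0)"
        using e DERIV_imp_deriv[OF dh[of 0]] by (simp add: uQ D0 Re norm_divide)
      finally show "(1 - (norm w)\<^sup>2) * (norm (deriv h w) / - Re (h w)) \<le> norm (deriv h 0) / - Re (h 0)" .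
    qed
    moreover have "u z0 = norm (deriv h 0) / - Re (h 0)"
      using e DERIV_imp_deriv[OF dh[of 0]] uQ[of 0] D0 unfolding \<phi>0 by (simp add: Re norm_divide)
    moreover have "0 < - Re (h 0)"
      using Re[of 0] e lnge[of "norm (Q 0 - \<gamma>)"] Q0 by auto
    ultimately show ?thesis by (simp only: pos_divide_le_eq)
  qed auto
  with max[of 0] have "u 0 \<le> 2" by simp
  then have "u 0 * \<delta> \<le> 2 * \<delta>" using \<delta> by (intro mult_right_mono) auto
  with u0 show ?thesis by simp
qed

text \<open>For \<open>s < 1\<close> the dilate of \<open>P\<close> by \<open>s\<close> is
  holomorphic on a disc of radius \<open>1 / s > 1\<close>, where the previous lemma applies; then
  \<open>s\<close> tends to \<open>1\<close>.\<close>

lemma omitted_net_deriv_bound: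
  assumes hol: "P holomorphic_on ball 0 1"
    and cl: "closed \<Gamma>" and net: "\<And>X::complex. \<exists>\<gamma>\<in>\<Gamma>. dist X \<gamma> < \<delta>"
    and om: "\<And>z. z \<in> ball 0 1 \<Longrightarrow> P z \<notin> \<Gamma>"
  shows "norm (deriv P 0) \<le> 2 * \<delta>"
proof (rule field_le_mult_one_interval)
  fix s :: real assume s: "0 < s" "s < 1"
  define Ps where "Ps z = P (of_real s * z)" for z
  have in1: "of_real s * z \<in> ball 0 1" if "z \<in> ball 0 (1 / s)" for z :: complex
    using that s by (simp add: norm_mult field_simps)
  have d: "(Ps has_field_derivative deriv P (of_real s * z) * of_real s) (at z)" if "z \<in> ball 0 (1 / s)" for z
    unfolding Ps_def[abs_def]
    by (rule DERIV_chain2[where g = "\<lambda>z. of_real s * z", OF holomorphic_derivI[OF hol open_ball in1[OF that]]])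
      (auto intro!: derivative_eq_intros)
  have "norm (deriv Ps 0) \<le> 2 * \<delta>"
  proof (rule omitted_net_deriv_bound_aux[OF _ _ cl net])
    show "Ps holomorphic_on ball 0 (1 / s)" unfolding holomorphic_on_open[OF open_ball] using d by blast
    show "1 < 1 / s" using s by simp
    show "Ps z \<notin> \<Gamma>" if "z \<in> ball 0 (1 / s)" for z using om[OF in1[OF that]] by (simp add: Ps_def)
  qed
  then show "s * norm (deriv P 0) \<le> 2 * \<delta>"
    using DERIV_imp_deriv[OF d[of 0]] s by (simp add: norm_mult mult.commute)
qed

section \<open>A Schottky estimate on a circle\<close>

text \<open>If \<open>exp l\<close> is never \<open>1\<close>, then \<open>l / (pi * \<i>)\<close>
  is never an even integer; after subtracting an odd integer it is never odd, so any
  \<open>P\<close> whose cosine is that function avoids this set.\<close>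

definition odd_cosine_net :: "complex set" where
  "odd_cosine_net = {X. \<exists>N::int. odd N \<and> cos X = of_int N}"

lemma closed_odd_cosine_net: "closed odd_cosine_net"
proof -
  have "odd_cosine_net = cos -` (of_int ` {N::int. odd N})"
    by (auto simp: odd_cosine_net_def)
  moreover have "closed (cos -` (of_int ` {N::int. odd N}) :: complex set)"
    by (intro closed_vimage closed_of_int_image continuous_intros)
  ultimately show ?thesis by simp
qed

lemma odd_int_in_interval:
  fixes a b :: real
  assumes "a + 2 \<le> b"
  obtains N :: int where "odd N" "a \<le> of_int N" "of_int N \<le> b"
proof -
  define k where "k = \<lceil>(a - 1) / 2\<rceil>"
  have "(a - 1) / 2 \<le> of_int k" "of_int k < (a - 1) / 2 + 1" unfolding k_def by linarith+
  then have "a \<le> of_int (2 * k + 1)" "of_int (2 * k + 1) \<le> b" using assms by (simp_all add: field_simps)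
  then show ?thesis by (intro that[of "2 * k + 1"]) auto
qed

text \<open>The estimate is narrow: \<open>1.03 ^ 30\<close> is about \<open>2.427\<close>, and
  \<open>2.42 - 1 / 2.42\<close> just exceeds \<open>2\<close>.\<close>

lemma sinh_9_10_ge_1: "1 \<le> sinh (9/10 :: real)"
proof -
  have "(1 + (9/10) / 30) ^ 30 \<le> exp (9/10 :: real)"
    using exp_ge_one_plus_x_over_n_power_n[of 30 "9/10"] by simp
  moreover have "242/100 \<le> (1 + (9/10) / 30 :: real) ^ 30" by (simp add: field_simps)
  ultimately have e: "242/100 \<le> exp (9/10 :: real)" by linarith
  then have "exp (- (9/10 :: real)) \<le> 100/242"
    by (simp add: exp_minus field_simps)
  with e show ?thesis by (simp add: sinh_def)
qed

text \<open>For \<open>y \<ge> 9/10\<close> the values of \<open>cosh\<close> at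
  \<open>y - 9/10\<close> and \<open>y + 9/10\<close> differ by
  \<open>2 * sinh y * sinh (9/10) \<ge> 2\<close>, which leaves room for an odd integer. For smaller
  \<open>y\<close> the point \<open>t = 0\<close> serves, with \<open>N = 1\<close>.\<close>

lemma cosh_near_odd_int:
  fixes y :: real
  assumes y: "0 \<le> y"
  obtains t N where "\<bar>t - y\<bar> \<le> 9/10" "odd (N::int)" "cosh t = of_int N"
proof (cases "y < 9/10")
  case True
  show ?thesis by (rule that[of 0 1]) (use True y in auto)
next
  case False
  have "cosh (y + 9/10) - cosh (y - 9/10) = 2 * (sinh y * sinh (9/10))"
    by (simp add: cosh_add cosh_diff)
  moreover have "1 * 1 \<le> sinh y * sinh (9/10)"
    using sinh_9_10_ge_1 False by (intro mult_mono) (auto intro: order_trans[OF sinh_9_10_ge_1])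
  ultimately have "cosh (y - 9/10) + 2 \<le> cosh (y + 9/10)" by linarith
  then obtain N :: int where N: "odd N" "cosh (y - 9/10) \<le> of_int N" "of_int N \<le> cosh (y + 9/10)"
    using odd_int_in_interval by metis
  have N1: "1 \<le> real_of_int N" using N(2) cosh_real_ge_1[of "y - 9/10"] by linarith
  define t where "t = arcosh (real_of_int N)"
  have t: "0 \<le> t" "cosh t = of_int N" using N1 by (simp_all add: t_def arcosh_nonneg_real)
  have "cosh (y - 9/10) \<le> cosh t" "cosh t \<le> cosh (y + 9/10)" using N t(2) by simp_all
  then have "y - 9/10 \<le> t" "t \<le> y + 9/10"
    using t(1) False by (simp_all add: cosh_real_nonneg_le_iff)
  then show ?thesis using N t by (intro that[of t N] abs_leI) auto
qed

text \<open>On a vertical line with real part in \<open>pi * \<int>\<close> the cosine is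
  \<open>cosh\<close> of the imaginary part up to sign. Such a line lies within
  \<open>pi / 2\<close> of \<open>X\<close>, and along it a net point is within height
  \<open>9/10\<close>; the hypotenuse is about \<open>1.81\<close>.\<close>

lemma odd_cosine_net_dense: "\<exists>\<gamma>\<in>odd_cosine_net. dist X \<gamma> < 183/100"
proof -
  define k where "k = round (Re X / pi)"
  obtain t N where t: "\<bar>t - \<bar>Im X\<bar>\<bar> \<le> 9/10" and N: "odd (N::int)" "cosh t = of_int N"
    using cosh_near_odd_int[of "\<bar>Im X\<bar>"] by auto
  define s where "s = (if Im X \<ge> 0 then t else - t)"
  have s: "\<bar>Im X - s\<bar> \<le> 9/10" "cosh s = of_int N" using t N by (auto simp: s_def split: abs_split)
  define \<gamma> where "\<gamma> = Complex (pi * of_int k) s"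
  have "cos \<gamma> = of_real (cos (pi * of_int k) * cosh s)"
    by (rule complex_eqI) (simp_all add: Re_cos Im_cos \<gamma>_def cosh_def sin_npi_int)
  also have "cos (pi * of_int k) = (if even k then 1 else -1)" by (rule cos_npi_int)
  finally have "cos \<gamma> = of_int (if even k then N else - N)" using s by auto
  then have "\<gamma> \<in> odd_cosine_net" using N unfolding odd_cosine_net_def
    by (intro CollectI exI[of _ "if even k then N else - N"]) auto
  moreover have "dist X \<gamma> < 183/100"
  proof -
    have "\<bar>of_int k - Re X / pi\<bar> \<le> 1/2" unfolding k_def by (rule of_int_round_abs_le)
    then have "pi * \<bar>of_int k - Re X / pi\<bar> \<le> pi * (1/2)" by (intro mult_left_mono) auto
    moreover have "\<bar>Re X - pi * of_int k\<bar> = pi * \<bar>of_int k - Re X / pi\<bar>"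
      by (simp add: abs_mult_pos' right_diff_distrib abs_minus_commute)
    moreover have "pi * (1/2) \<le> 15708/10000" using pi_approx(2) by simp
    ultimately have "\<bar>Re X - pi * of_int k\<bar> \<le> 15708/10000" by (metis order_trans)
    then have "(Re X - pi * of_int k)\<^sup>2 \<le> (15708/10000)\<^sup>2"
      by (metis abs_ge_zero power2_abs power_mono)
    moreover have "(Im X - s)\<^sup>2 \<le> (9/10)\<^sup>2"
      using s by (metis abs_ge_zero power2_abs power_mono)
    ultimately have "(dist X \<gamma>)\<^sup>2 < (183/100)\<^sup>2"
      unfolding dist_norm cmod_power2 \<gamma>_def by (simp add: power2_eq_square)
    then show ?thesis by (rule power2_less_imp_less) simp
  qed
  ultimately show ?thesis by blast
qed

lemma pi_le_31416: "pi \<le> 31416/10000"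
  using pi_approx(2) by simp

section \<open>Transfer of the derivative bound from the disc to a strip\<close>

text \<open>This Moebius map takes \<open>0\<close> to \<open>cis \<alpha>\<close>; its imaginary
  part is \<open>sin \<alpha>\<close> times the Poisson kernel
  \<open>(1 - (norm z)\<^sup>2) / (norm (1 - z))\<^sup>2\<close>.\<close>

lemma disc_to_half_plane_Im:
  fixes z :: complex
  assumes z: "norm z < 1" and s: "0 < sin \<alpha>"
  shows "0 < Im ((cis \<alpha> - cnj (cis \<alpha>) * z) / (1 - z))"
proof -
  define D where "D = (Re (1 - z))\<^sup>2 + (Im (1 - z))\<^sup>2"
  have "z \<noteq> 1" using z by auto
  then have D: "0 < D" unfolding D_def
    by (metis cmod_power2 eq_iff_diff_eq_0 norm_eq_zero zero_less_power2)
  have "Im ((cis \<alpha> - cnj (cis \<alpha>) * z) / (1 - z)) = sin \<alpha> * (1 - (norm z)\<^sup>2) / D"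
    unfolding Im_divide D_def cmod_power2 by (simp add: power2_eq_square algebra_simps)
  moreover have "(norm z)\<^sup>2 < 1" using z by (simp add: abs_square_less_1)
  ultimately show ?thesis using s D by simp
qed

text \<open>The half-plane map followed by a scaled and rotated logarithm carries the disc into the
  strip and \<open>0\<close> to \<open>\<zeta>0\<close>. Its derivative at \<open>0\<close> has norm
  \<open>2 * \<Lambda> * sin \<alpha> / pi\<close>, by which the disc bound
  \<open>2 * \<delta>\<close> is divided.\<close>

lemma strip_omitted_net_deriv_bound:
  fixes P :: "complex \<Rightarrow> complex"
  assumes hol: "P holomorphic_on {\<zeta>. - \<Lambda> < Re \<zeta> \<and> Re \<zeta> < 0}" and \<Lambda>: "0 < \<Lambda>"
    and \<alpha>: "0 < \<alpha>" "\<alpha> < pi" and \<zeta>0: "Re \<zeta>0 = - \<Lambda> * \<alpha> / pi"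
    and cl: "closed \<Gamma>" and net: "\<And>X::complex. \<exists>\<gamma>\<in>\<Gamma>. dist X \<gamma> < \<delta>"
    and om: "\<And>\<zeta>. - \<Lambda> < Re \<zeta> \<Longrightarrow> Re \<zeta> < 0 \<Longrightarrow> P \<zeta> \<notin> \<Gamma>"
  shows "norm (deriv P \<zeta>0) \<le> \<delta> * pi / (\<Lambda> * sin \<alpha>)"
proof -
  define S where "S = {\<zeta>::complex. - \<Lambda> < Re \<zeta> \<and> Re \<zeta> < 0}"
  have opS: "open S"
    unfolding S_def by (intro open_Collect_conj open_halfspace_Re_gt open_halfspace_Re_lt)
  have s: "0 < sin \<alpha>" using \<alpha> by (rule sin_gt_zero)
  define c where "c = \<Lambda> / pi"
  have c: "0 < c" using \<Lambda> by (simp add: c_def)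
  define \<tau> where "\<tau> z = (cis \<alpha> - cnj (cis \<alpha>) * z) / (1 - z)" for z
  define \<psi> where "\<psi> z = \<i> * Im \<zeta>0 + c * \<i> * Ln (\<tau> z)" for z
  have Im\<tau>: "0 < Im (\<tau> z)" if "norm z < 1" for z
    unfolding \<tau>_def by (rule disc_to_half_plane_Im[OF that s])
  have \<psi>S: "\<psi> z \<in> S" if "norm z < 1" for z
  proof -
    have *: "0 < Im (Ln (\<tau> z))" "Im (Ln (\<tau> z)) < pi" using Im_Ln_pos_lt_imp[OF Im\<tau>[OF that]] by auto
    have "Re (\<psi> z) = - (c * Im (Ln (\<tau> z)))" by (simp add: \<psi>_def)
    moreover have "0 < c * Im (Ln (\<tau> z))" "c * Im (Ln (\<tau> z)) < c * pi" using * c by auto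
    moreover have "c * pi = \<Lambda>" by (simp add: c_def)
    ultimately show ?thesis by (simp add: S_def)
  qed
  have d\<tau>: "(\<tau> has_field_derivative (cis \<alpha> - cnj (cis \<alpha>)) / (1 - z)\<^sup>2) (at z)" if "norm z < 1" for z
  proof -
    have "z \<noteq> 1" using that by auto
    then have "(\<tau> has_field_derivative
        (- cnj (cis \<alpha>) * (1 - z) - (cis \<alpha> - cnj (cis \<alpha>) * z) * (- 1)) / ((1 - z) * (1 - z))) (at z)"
      unfolding \<tau>_def[abs_def] by (auto intro!: derivative_eq_intros)
    moreover have "- cnj (cis \<alpha>) * (1 - z) - (cis \<alpha> - cnj (cis \<alpha>) * z) * (- 1) = cis \<alpha> - cnj (cis \<alpha>)"
      by (simp add: algebra_simps)
    ultimately show ?thesis by (simp only: power2_eq_square)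
  qed
  have d\<psi>: "(\<psi> has_field_derivative
      c * \<i> * (inverse (\<tau> z) * ((cis \<alpha> - cnj (cis \<alpha>)) / (1 - z)\<^sup>2))) (at z)" if "norm z < 1" for z
  proof -
    have "\<tau> z \<notin> \<real>\<^sub>\<le>\<^sub>0" using Im\<tau>[OF that] by (auto simp: complex_nonpos_Reals_iff)
    from DERIV_chain2[OF has_field_derivative_Ln[OF this] d\<tau>[OF that]]
    have "((\<lambda>z. c * \<i> * Ln (\<tau> z)) has_field_derivative
      c * \<i> * (inverse (\<tau> z) * ((cis \<alpha> - cnj (cis \<alpha>)) / (1 - z)\<^sup>2))) (at z)"
      by (rule DERIV_cmult)
    then show ?thesis unfolding \<psi>_def[abs_def] using DERIV_add[OF DERIV_const] by fastforce
  qed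
  have \<tau>0: "\<tau> 0 = cis \<alpha>" by (simp add: \<tau>_def)
  have "Ln (cis \<alpha>) = \<i> * \<alpha>"
    by (rule Ln_unique) (use \<alpha> in \<open>auto simp: cis_conv_exp\<close>)
  then have \<psi>0: "\<psi> 0 = \<zeta>0"
    unfolding \<psi>_def \<tau>0 by (intro complex_eqI) (simp_all add: \<zeta>0 c_def)
  have dP: "((\<lambda>z. P (\<psi> z)) has_field_derivative deriv P (\<psi> z) *
      (c * \<i> * (inverse (\<tau> z) * ((cis \<alpha> - cnj (cis \<alpha>)) / (1 - z)\<^sup>2)))) (at z)" if "norm z < 1" for z
    by (rule DERIV_chain2[OF holomorphic_derivI[OF hol[folded S_def] opS \<psi>S[OF that]] d\<psi>[OF that]])
  have "norm (deriv (\<lambda>z. P (\<psi> z)) 0) \<le> 2 * \<delta>"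
  proof (rule omitted_net_deriv_bound[OF _ cl net])
    show "(\<lambda>z. P (\<psi> z)) holomorphic_on ball 0 1"
      unfolding holomorphic_on_open[OF open_ball] using dP by (metis mem_ball_0)
    show "P (\<psi> z) \<notin> \<Gamma>" if "z \<in> ball 0 1" for z
      using \<psi>S[of z] that om by (auto simp: S_def)
  qed
  moreover have "norm (cis \<alpha> - cnj (cis \<alpha>)) = 2 * sin \<alpha>"
    using s by (simp add: complex_diff_cnj norm_mult)
  ultimately have "norm (deriv P \<zeta>0) * (c * (2 * sin \<alpha>)) \<le> 2 * \<delta>"
    using c by (simp add: DERIV_imp_deriv[OF dP[of 0]] \<psi>0 \<tau>0 norm_mult norm_inverse)
  then have "norm (deriv P \<zeta>0) * (\<Lambda> * sin \<alpha>) \<le> \<delta> * pi"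
    by (simp add: c_def field_simps)
  then show ?thesis
    using \<Lambda> s by (simp add: pos_le_divide_eq)
qed

lemma abs_Im_cos_le: "\<bar>Im (cos z)\<bar> \<le> exp \<bar>Im z\<bar> / 2" for z :: complex
proof -
  have "\<bar>Im (cos z)\<bar> = \<bar>sin (Re z)\<bar> * \<bar>exp (- Im z) - exp (Im z)\<bar> / 2"
    by (simp add: Im_cos abs_mult)
  also have "\<dots> \<le> 1 * exp \<bar>Im z\<bar> / 2"
    by (intro divide_right_mono mult_mono) (auto simp: abs_if)
  finally show ?thesis by simp
qed

text \<open>Off the real axis, a real cosine forces \<open>sin (Re z) = 0\<close>, so its absolute
  value is \<open>cosh (Im z) > 1\<close>.\<close>

lemma real_cos_imp_real:
  fixes z :: complex
  assumes "Im (cos z) = 0" "\<bar>Re (cos z)\<bar> \<le> 1"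
  shows "Im z = 0"
proof (rule ccontr)
  assume nz: "Im z \<noteq> 0"
  have "Im (cos z) = - (sin (Re z) * sinh (Im z))" "Re (cos z) = cos (Re z) * cosh (Im z)"
    by (simp_all add: Im_cos Re_cos sinh_def cosh_def algebra_simps diff_divide_distrib)
  with assms nz have s: "sin (Re z) = 0" and c: "\<bar>cos (Re z) * cosh (Im z)\<bar> \<le> 1" by auto
  have "(cos (Re z))\<^sup>2 = 1" using s sin_cos_squared_add[of "Re z"] by simp
  then have "\<bar>cos (Re z)\<bar> = 1" by (simp add: abs_square_eq_1)
  with c have "cosh (Im z) \<le> 1" by (simp add: abs_mult)
  moreover have "cosh 0 < cosh \<bar>Im z\<bar>" using nz by (subst cosh_real_nonneg_less_iff) auto
  ultimately show False by simp
qed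

lemma exp_of_nat_bounds:
  shows "exp (of_nat n :: real) \<le> (272/100) ^ n" "(27/10) ^ n \<le> exp (of_nat n :: real)"
proof -
  have "exp (1::real) \<le> 272/100" using e_less_272 by simp
  then have "exp (1::real) ^ n \<le> (272/100) ^ n" by (intro power_mono) auto
  then show "exp (of_nat n :: real) \<le> (272/100) ^ n" by (simp flip: exp_of_nat_mult)
  have "27/10 \<le> exp (1::real)" using abs_le_D2[OF e_approx_32] by simp
  then have "(27/10) ^ n \<le> exp (1::real) ^ n" by (intro power_mono) auto
  then show "(27/10) ^ n \<le> exp (of_nat n :: real)" by (simp flip: exp_of_nat_mult)
qed

text \<open>
  The lift of the circle to the strip \<open>- 21/2 < Re \<zeta> < 0\<close> is the line \<open>Re \<zeta> = - 7/2\<close>, which corresponds to the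
  angle \<open>\<alpha> = pi / 3\<close>. Two points of the circle are joined by a segment of length at most \<open>pi\<close> on this line.
\<close>

lemma Schottky_on_circle:
  fixes f :: "complex \<Rightarrow> complex"
  assumes hol: "f holomorphic_on ball 0 1"
    and om: "\<And>z. exp (- 21/2) < norm z \<Longrightarrow> norm z < 1 \<Longrightarrow> f z \<noteq> 0 \<and> f z \<noteq> 1"
    and z0: "norm z0 = exp (- 7/2)" "norm (f z0) \<le> 1" and z: "norm z = exp (- 7/2)"
  shows "norm (f z) \<le> exp 12"
proof (cases "norm (f z) \<le> 1")
  case True
  also have "(1::real) \<le> exp 12" by simp
  finally show ?thesis .
next
  case False
  define S where "S = {\<zeta>::complex. - (21/2) < Re \<zeta> \<and> Re \<zeta> < 0}"
  have opS: "open S"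
    unfolding S_def by (intro open_Collect_conj open_halfspace_Re_gt open_halfspace_Re_lt)
  have "S = {\<zeta>. - (21/2) < Re \<zeta>} \<inter> {\<zeta>. Re \<zeta> < 0}" by (auto simp: S_def)
  then have "convex S" by (simp add: convex_Int convex_halfspace_Re_gt convex_halfspace_Re_lt)
  then have contr: "contractible S" by (rule convex_imp_contractible)
  have expS: "exp (- 21/2) < norm (exp \<zeta>)" "norm (exp \<zeta>) < 1" if "\<zeta> \<in> S" for \<zeta>
    using that by (auto simp: S_def)
  have nz0: "z0 \<noteq> 0" using z0 by auto
  define \<theta> where "\<theta> = Arg (z / z0)"
  have \<theta>: "\<bar>\<theta>\<bar> \<le> pi" unfolding \<theta>_def using Arg_bounded[of "z / z0"] by linarith
  define p where "p t = Ln z0 + \<i> * of_real (\<theta> * t)" for t :: real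
  have Rep: "Re (p t) = - (7/2)" for t using nz0 z0 by (simp add: p_def)
  have pS: "p t \<in> S" for t by (simp add: S_def Rep)
  have p0: "exp (p 0) = z0" using nz0 by (simp add: p_def)
  have p1: "exp (p 1) = z"
  proof -
    have "z / z0 = of_real (norm (z / z0)) * exp (\<i> * of_real \<theta>)"
      unfolding \<theta>_def using nz0 z by (intro Arg_eq) auto
    moreover have "norm (z / z0) = 1" using z z0 by (simp add: norm_divide)
    ultimately show ?thesis using nz0 by (simp add: p_def exp_add field_simps)
  qed
  have holF: "(\<lambda>\<zeta>. f (exp \<zeta>)) holomorphic_on S"
    by (rule holomorphic_on_compose_gen[OF holomorphic_on_exp hol, unfolded o_def]) (use expS in auto)
  have nzF: "f (exp \<zeta>) \<noteq> 0" "f (exp \<zeta>) \<noteq> 1" if "\<zeta> \<in> S" for \<zeta>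
    using om[OF expS[OF that]] by auto
  have "continuous_on {0..1} (\<lambda>t. norm (f (exp (p t))))"
  proof (rule continuous_on_norm)
    show "continuous_on {0..1} (\<lambda>t. f (exp (p t)))"
      by (rule continuous_on_compose2[OF holomorphic_on_imp_continuous_on[OF holF]])
        (use pS in \<open>auto simp: p_def intro!: continuous_intros\<close>)
  qed
  \<comment> \<open>On the arc from \<open>z0\<close> to \<open>z\<close> the modulus of
    \<open>f\<close> passes from at most \<open>1\<close> to above \<open>1\<close>. A point where
    it equals \<open>1\<close> anchors the estimate, because \<open>c\<close> is real there.\<close>
  then obtain t where t: "0 \<le> t" "t \<le> 1" "norm (f (exp (p t))) = 1"
    using IVT'[of "\<lambda>t. norm (f (exp (p t)))" 0 1 1] z0 False by (auto simp: p0 p1)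
  obtain l where holl: "l holomorphic_on S" and l: "\<And>\<zeta>. \<zeta> \<in> S \<Longrightarrow> f (exp \<zeta>) = exp (l \<zeta>)"
    using contractible_imp_holomorphic_log[OF holF contr nzF(1)] by metis
  \<comment> \<open>The branch of the logarithm is chosen so that \<open>c\<close> takes a value in \<open>[-1,1]\<close> at \<open>p t\<close>, whence \<open>P (p t)\<close> is real.\<close>
  define k where "k = \<lfloor>Im (l (p t)) / (2 * pi)\<rfloor>"
  define c where "c \<zeta> = - \<i> * l \<zeta> / of_real pi - of_int (2 * k + 1)" for \<zeta>
  have holc: "c holomorphic_on S"
    unfolding c_def by (intro holomorphic_intros holl) auto
  have Rec: "Re (c \<zeta>) = Im (l \<zeta>) / pi - 2 * of_int k - 1"
    and Imc: "Im (c \<zeta>) = - Re (l \<zeta>) / pi" for \<zeta>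
    by (simp_all add: c_def)
  \<comment> \<open>An odd value of \<open>c\<close> would make \<open>l \<zeta>\<close> an even
    multiple of \<open>pi * \<i>\<close>, and hence \<open>f (exp \<zeta>) = 1\<close>.\<close>
  have c_omits: "c \<zeta> \<noteq> of_int N" if "\<zeta> \<in> S" "odd N" for \<zeta> N
  proof
    assume "c \<zeta> = of_int N"
    then have "\<i> * (of_real pi * (- \<i> * l \<zeta> / of_real pi)) = \<i> * (of_real pi * of_int (N + (2 * k + 1)))"
      unfolding c_def by (simp add: algebra_simps)
    moreover have "\<i> * (of_real pi * (- \<i> * l \<zeta> / of_real pi)) = l \<zeta>" by simp
    moreover obtain M where "N = 2 * M + 1" using \<open>odd N\<close> by (rule oddE)
    ultimately have "l \<zeta> = \<i> * (of_real pi * of_int (2 * (M + 1 + k)))"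
      by (simp add: algebra_simps)
    then have "Re (l \<zeta>) = 0 \<and> Im (l \<zeta>) = of_int (2 * (M + 1 + k)) * pi" by simp
    then have "exp (l \<zeta>) = 1" unfolding exp_eq_1 by blast
    then show False using l[OF that(1)] nzF(2)[OF that(1)] by simp
  qed
  obtain P where holP: "P holomorphic_on S" and P: "\<And>\<zeta>. \<zeta> \<in> S \<Longrightarrow> c \<zeta> = cos (P \<zeta>)"
    using contractible_imp_holomorphic_arccos[OF holc contr] c_omits[of _ 1] c_omits[of _ "-1"] by auto
  have dP: "norm (deriv P \<zeta>) \<le> 183/100 * pi / (21/2 * sin (pi/3))" if "Re \<zeta> = - (7/2)" for \<zeta>
  proof (rule strip_omitted_net_deriv_bound[OF _ _ _ _ _ closed_odd_cosine_net odd_cosine_net_dense])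
    show "P holomorphic_on {\<zeta>. - (21/2) < Re \<zeta> \<and> Re \<zeta> < 0}" using holP by (simp add: S_def)
    show "P \<zeta> \<notin> odd_cosine_net" if "- (21/2) < Re \<zeta>" "Re \<zeta> < 0" for \<zeta>
      using P[of \<zeta>] c_omits[of \<zeta>] that unfolding odd_cosine_net_def S_def by auto
  qed (use that in auto)
  have P_bound: "norm (P (p 1) - P (p t)) \<le> 183/100 * pi / (21/2 * sin (pi/3)) * norm (p 1 - p t)"
  proof (rule field_differentiable_bound[where S = "{\<zeta>. Re \<zeta> = - (7/2)}"])
    show "convex {\<zeta>. Re \<zeta> = - (7/2)}" using convex_hyperplane[of "1::complex" "- (7/2)"] by simp
    show "(P has_field_derivative deriv P \<zeta>) (at \<zeta> within {\<zeta>. Re \<zeta> = - (7/2)})"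
      if "\<zeta> \<in> {\<zeta>. Re \<zeta> = - (7/2)}" for \<zeta>
      using that by (intro holomorphic_derivI[OF holP opS]) (auto simp: S_def)
  qed (use dP Rep in auto)
  have p_bound: "norm (p 1 - p t) \<le> pi"
  proof -
    have "p 1 - p t = \<i> * of_real (\<theta> * (1 - t))" by (simp add: p_def algebra_simps)
    then have "norm (p 1 - p t) = \<bar>\<theta>\<bar> * (1 - t)" using t by (simp only: norm_mult norm_ii norm_of_real abs_mult)
    also have "\<dots> \<le> pi * 1" using \<theta> t by (intro mult_mono) auto
    finally show ?thesis by simp
  qed
  \<comment> \<open>There is little slack: \<open>1.83 * pi ^ 2\<close> is about
    \<open>18.06\<close>, against about \<open>18.19\<close> for
    \<open>21 * sin (pi/3)\<close>.\<close>
  have "183/100 * pi / (21/2 * sin (pi/3)) * pi \<le> 2"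
  proof -
    have "(866/1000)\<^sup>2 \<le> (3::real)/4" by (simp add: power2_eq_square)
    then have "866/1000 \<le> sqrt (3/4 :: real)" by (rule real_le_rsqrt)
    also have "sqrt (3/4) = sin (pi/3)" by (simp add: sin_60 real_sqrt_divide)
    finally have s: "866/1000 \<le> sin (pi/3)" .
    have "pi * pi \<le> 31416/10000 * (31416/10000)"
      by (intro mult_mono pi_le_31416) auto
    then have "183/100 * (pi * pi) \<le> 2 * (21/2 * sin (pi/3))" using s by simp
    then show ?thesis using s by (simp add: field_simps)
  qed
  moreover have "183/100 * pi / (21/2 * sin (pi/3)) * norm (p 1 - p t) \<le> 183/100 * pi / (21/2 * sin (pi/3)) * pi"
    by (intro mult_left_mono p_bound) (simp add: sin_60)
  ultimately have "norm (P (p 1) - P (p t)) \<le> 2" using P_bound by linarith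
  then have "\<bar>Im (P (p 1)) - Im (P (p t))\<bar> \<le> 2"
    using abs_Im_le_cmod[of "P (p 1) - P (p t)"] by simp
  moreover have "Im (P (p t)) = 0"
  proof (rule real_cos_imp_real)
    have "norm (exp (l (p t))) = 1" using t l[OF pS] by simp
    then have "Re (l (p t)) = 0" by simp
    then show "Im (cos (P (p t))) = 0" by (simp flip: P[OF pS] add: Imc)
    have "of_int k \<le> Im (l (p t)) / (2 * pi)" "Im (l (p t)) / (2 * pi) < of_int k + 1"
      unfolding k_def by linarith+
    then show "\<bar>Re (cos (P (p t)))\<bar> \<le> 1"
      by (simp flip: P[OF pS] add: Rec abs_le_iff field_simps)
  qed
  ultimately have "\<bar>Im (P (p 1))\<bar> \<le> 2" by simp
  \<comment> \<open>Since \<open>Im c\<close> is \<open>- ln (norm f) / pi\<close>, the bound on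
    \<open>Im (cos P)\<close> yields \<open>ln (norm f) \<le> pi * exp 2 / 2\<close>, which is below
    \<open>12\<close>.\<close>
  then have "exp \<bar>Im (P (p 1))\<bar> / 2 \<le> exp 2 / 2" by simp
  with abs_Im_cos_le[of "P (p 1)"] have "\<bar>Im (c (p 1))\<bar> \<le> exp 2 / 2"
    unfolding P[OF pS] by (rule order_trans)
  also have "\<dots> \<le> (272/100)\<^sup>2 / 2" using exp_of_nat_bounds(1)[of 2] by simp
  finally have "\<bar>Re (l (p 1))\<bar> \<le> (272/100)\<^sup>2 / 2 * pi"
    by (simp add: Imc field_simps)
  also have "\<dots> \<le> (272/100)\<^sup>2 / 2 * (31416/10000)" by (intro mult_left_mono pi_le_31416) auto
  also have "\<dots> \<le> 12" by (simp add: power2_eq_square)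
  finally have "Re (l (p 1)) \<le> 12" by simp
  moreover have "norm (f z) = exp (Re (l (p 1)))" using l[OF pS[of 1]] by (simp add: p1)
  ultimately show ?thesis by simp
qed

section \<open>Zeros, logarithmic derivatives and Harnack's inequality\<close>

text \<open>The polynomial \<open>q\<close> formed from the zeros and their orders has the same
  order as \<open>f\<close> at every point of \<open>S\<close>, so the quotient extends to a
  zero-free holomorphic function. Connectedness and \<open>nz\<close> ensure that
  \<open>zorder\<close> is the true multiplicity.\<close>

lemma holomorphic_factor_zeros:
  fixes f :: "complex \<Rightarrow> complex"
  assumes hol: "f holomorphic_on S" and S: "open S" "connected S"
    and Z_def: "Z = {z \<in> S. f z = 0}" and finZ: "finite Z" and nz: "\<exists>z\<in>S. f z \<noteq> 0"
  obtains m k where "k holomorphic_on S" "\<And>z. z \<in> S \<Longrightarrow> k z \<noteq> 0"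
    "\<And>z. z \<in> S \<Longrightarrow> f z = (\<Prod>a\<in>Z. (z - a) ^ m a) * k z"
    "\<And>a. a \<in> Z \<Longrightarrow> zorder f a = int (m a) \<and> 0 < m a"
proof -
  define m where "m a = nat (zorder f a)" for a
  define q where "q z = (\<Prod>a\<in>Z. (z - a) ^ m a)" for z
  have ord: "if f z = 0 then 0 < zorder f z else zorder f z = 0" if "z \<in> S" for z
    using zorder_exist_zero[OF hol S that nz] by blast
  have m: "zorder f a = int (m a) \<and> 0 < m a" if "a \<in> S" "f a = 0" for a
    using ord[OF that(1)] that(2) by (simp add: m_def)
  have q0: "q z = 0 \<longleftrightarrow> f z = 0" if "z \<in> S" for z
  proof
    assume "q z = 0"
    then obtain a where "a \<in> Z" "(z - a) ^ m a = 0" using finZ by (auto simp: q_def)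
    then show "f z = 0" by (auto simp: Z_def)
  next
    assume "f z = 0"
    then show "q z = 0" unfolding q_def using finZ m[OF that] that
      by (intro prod_zero bexI[of _ z]) (auto simp: Z_def)
  qed
  have holq: "q holomorphic_on T" for T
    unfolding q_def by (intro holomorphic_intros)
  have qo: "zorder q z = zorder f z" if z: "z \<in> S" for z
  proof (cases "f z = 0")
    case True
    define g where "g w = (\<Prod>a\<in>Z - {z}. (w - a) ^ m a)" for w
    have zZ: "z \<in> Z" using z True by (simp add: Z_def)
    have "zorder q z = int (m z)"
    proof (rule zorder_eqI[of UNIV z g])
      show "g holomorphic_on UNIV" unfolding g_def by (intro holomorphic_intros)
      show "g z \<noteq> 0" unfolding g_def using finZ by auto
      show "q w = g w * (w - z) powi int (m z)" if "w \<in> UNIV" "w \<noteq> z" for w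
        unfolding q_def g_def using prod.remove[OF finZ zZ, of "\<lambda>a. (w - a) ^ m a"] by simp
    qed auto
    with m[OF z True] show ?thesis by simp
  next
    case False
    have "q analytic_on {z}" using holq[of UNIV] by (intro holomorphic_on_imp_analytic_at[of _ UNIV]) auto
    then have "zorder q z = 0" by (rule zorder_eq_0I) (use q0[OF z] False in auto)
    then show ?thesis using ord[OF z] False by simp
  qed
  obtain k where "k holomorphic_on S" "\<And>z. z \<in> S \<Longrightarrow> k z \<noteq> 0" "\<And>z. z \<in> S \<Longrightarrow> f z = k z * q z"
    using holomorphic_zorder_factorization[OF hol S holq q0 qo] by metis
  then show ?thesis
    using m by (intro that[of k m]) (auto simp: q_def Z_def mult.commute)
qed

lemma prod_power_bounds:
  fixes x :: "'a \<Rightarrow> real"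
  assumes "\<And>a. a \<in> A \<Longrightarrow> 0 \<le> x a"
  shows prod_power_le: "(\<And>a. a \<in> A \<Longrightarrow> x a \<le> D) \<Longrightarrow> (\<Prod>a\<in>A. x a ^ m a) \<le> D ^ (\<Sum>a\<in>A. m a)"
    and prod_power_ge: "0 \<le> D \<Longrightarrow> (\<And>a. a \<in> A \<Longrightarrow> D \<le> x a) \<Longrightarrow> D ^ (\<Sum>a\<in>A. m a) \<le> (\<Prod>a\<in>A. x a ^ m a)"
  using assms by (auto simp: power_sum intro!: prod_mono power_mono)

text \<open>After normalising so that \<open>g 0 = - A\<close> is real, the Schwarz lemma applies to
  the Cayley transform of \<open>g\<close>. The resulting inequality
  \<open>norm (g w + A) \<le> t * norm (g w - A)\<close> bounds the real part.\<close>

lemma Harnack_left_half_plane: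
  fixes G :: "complex \<Rightarrow> complex"
  assumes hol: "G holomorphic_on ball b \<rho>" and neg: "\<And>z. z \<in> ball b \<rho> \<Longrightarrow> Re (G z) < 0"
    and t: "0 \<le> t" "t < 1" and z: "norm (z - b) \<le> t * \<rho>" and \<rho>: "0 < \<rho>"
  shows "Re (G z) \<le> (1 - t) / (1 + t) * Re (G b)"
proof -
  define g where "g w = G (b + of_real \<rho> * w) - \<i> * Im (G b)" for w
  define A where "A = - Re (G b)"
  have A: "0 < A" using neg[of b] \<rho> by (simp add: A_def)
  have in_ball: "b + of_real \<rho> * w \<in> ball b \<rho>" if "norm w < 1" for w
    using that \<rho> by (simp add: dist_norm norm_mult)
  have Re_g: "Re (g w) < 0" if "norm w < 1" for w
    using neg[OF in_ball[OF that]] by (simp add: g_def)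
  have g0: "g 0 = - of_real A" by (simp add: g_def A_def complex_eq_iff)
  have holg: "g holomorphic_on ball 0 1"
    unfolding g_def
    by (intro holomorphic_intros holomorphic_on_compose_gen[OF _ hol, unfolded o_def])
      (use in_ball in \<open>auto intro!: holomorphic_intros\<close>)
  have nz: "g w - of_real A \<noteq> 0" if "norm w < 1" for w
  proof -
    have "Re (g w - of_real A) < 0" using Re_g[OF that] A by simp
    then show ?thesis by auto
  qed
  define \<psi> where "\<psi> w = (g w + of_real A) / (g w - of_real A)" for w
  have hol\<psi>: "\<psi> holomorphic_on ball 0 1"
    unfolding \<psi>_def using nz by (intro holomorphic_intros holg) auto
  have \<psi>0: "\<psi> 0 = 0" by (simp add: \<psi>_def g0)
  have \<psi>1: "norm (\<psi> w) < 1" if "norm w < 1" for w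
  proof -
    have "(norm (g w + of_real A))\<^sup>2 < (norm (g w - of_real A))\<^sup>2"
      unfolding cmod_power2 using Re_g[OF that] A by (simp add: power2_eq_square algebra_simps mult_pos_neg)
    then have "norm (g w + of_real A) < norm (g w - of_real A)" by (rule power2_less_imp_less) simp
    then show ?thesis using nz[OF that] by (simp add: \<psi>_def norm_divide)
  qed
  define w where "w = (z - b) / of_real \<rho>"
  have w: "norm w \<le> t" "b + of_real \<rho> * w = z"
    using z \<rho> by (simp_all add: w_def norm_divide field_simps)
  have w1: "norm w < 1" using w t by simp
  have "norm (\<psi> w) \<le> norm w" by (rule Schwarz_Lemma(1)[OF hol\<psi> \<psi>0 \<psi>1 w1])
  then have n: "norm (\<psi> w) \<le> t" using w by simp
  define X where "X = - Re (g w)"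
  have X: "0 < X" using Re_g[OF w1] by (simp add: X_def)
  have "norm (g w + of_real A) \<le> t * norm (g w - of_real A)"
    using n nz[OF w1] by (simp add: \<psi>_def norm_divide pos_divide_le_eq)
  then have "(norm (g w + of_real A))\<^sup>2 \<le> (t * norm (g w - of_real A))\<^sup>2" by (intro power_mono) auto
  then have "(A - X)\<^sup>2 + (Im (g w))\<^sup>2 \<le> t\<^sup>2 * ((A + X)\<^sup>2 + (Im (g w))\<^sup>2)"
    unfolding power_mult_distrib cmod_power2 X_def by (simp add: power2_eq_square algebra_simps)
  moreover have "t\<^sup>2 * (Im (g w))\<^sup>2 \<le> 1 * (Im (g w))\<^sup>2"
    using t by (intro mult_right_mono) (auto simp: abs_square_le_1)
  ultimately have "(A - X)\<^sup>2 \<le> t\<^sup>2 * (A + X)\<^sup>2" unfolding distrib_left by linarith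
  then have "(A - X)\<^sup>2 \<le> (t * (A + X))\<^sup>2" unfolding power_mult_distrib .
  then have "A - X \<le> t * (A + X)" by (rule power2_le_imp_le) (use A X t in simp)
  then have "(1 - t) * A \<le> X * (1 + t)" by (simp add: algebra_simps)
  then have "(1 - t) * A / (1 + t) \<le> X" using t by (simp add: pos_divide_le_eq)
  moreover have "Re (G z) = - X" by (simp add: X_def g_def w)
  ultimately show ?thesis by (simp add: A_def)
qed

section \<open>Moments of zeros as contour integrals\<close>

lemma log_deriv_factored:
  fixes f k :: "complex \<Rightarrow> complex"
  assumes eq: "\<And>z. z \<in> S \<Longrightarrow> f z = (\<Prod>a\<in>A. (z - a) ^ m a) * k z"
    and S: "open S" "z \<in> S" and k: "k holomorphic_on S" "k z \<noteq> 0" and A: "finite A" "z \<notin> A"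
  shows "deriv f z / f z = (\<Sum>a\<in>A. of_nat (m a) / (z - a)) + deriv k z / k z"
proof -
  have kz: "(k has_field_derivative deriv k z) (at z)" using k(1) S by (rule holomorphic_derivI)
  have p: "((\<lambda>w. \<Prod>a\<in>A. (w - a) ^ m a) has_field_derivative
      (\<Prod>a\<in>A. (z - a) ^ m a) * (\<Sum>a\<in>A. of_nat (m a) / (z - a))) (at z)"
    using A
  proof (induction A rule: finite_induct)
    case (insert x A)
    have "((\<lambda>w. (w - x) ^ m x) has_field_derivative of_nat (m x) * (z - x) ^ (m x - 1)) (at z)"
      by (auto intro!: derivative_eq_intros)
    moreover have "of_nat (m x) * (z - x) ^ (m x - 1) = (z - x) ^ m x * (of_nat (m x) / (z - x))"
      using insert.prems by (cases "m x") auto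
    ultimately have "((\<lambda>w. (w - x) ^ m x) has_field_derivative (z - x) ^ m x * (of_nat (m x) / (z - x))) (at z)"
      by simp
    from DERIV_mult[OF this insert.IH] insert show ?case by (simp add: algebra_simps)
  qed simp
  define q where "q = (\<Prod>a\<in>A. (z - a) ^ m a)"
  have q: "q \<noteq> 0" using A by (auto simp: q_def)
  have "((\<lambda>w. (\<Prod>a\<in>A. (w - a) ^ m a) * k w) has_field_derivative
      q * (\<Sum>a\<in>A. of_nat (m a) / (z - a)) * k z + deriv k z * q) (at z)"
    using DERIV_mult[OF p kz] by (simp add: q_def)
  then have "(f has_field_derivative
      q * (\<Sum>a\<in>A. of_nat (m a) / (z - a)) * k z + deriv k z * q) (at z)"
    by (rule has_field_derivative_transform_within_open[OF _ S]) (simp add: eq)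
  then have "deriv f z = q * (\<Sum>a\<in>A. of_nat (m a) / (z - a)) * k z + deriv k z * q"
    by (rule DERIV_imp_deriv)
  moreover have "f z = q * k z" using eq[OF S(2)] by (simp add: q_def)
  ultimately show ?thesis using q k(2) by (simp add: add_divide_distrib)
qed

text \<open>Each factor contributes \<open>m a * z / (z - a)\<close>, evaluated by Cauchy's formula;
  the zero-free factor contributes a holomorphic integrand with integral \<open>0\<close>.\<close>

lemma contour_integral_log_deriv_moment:
  fixes f k :: "complex \<Rightarrow> complex"
  assumes eq: "\<And>z. z \<in> ball 0 1 \<Longrightarrow> f z = (\<Prod>a\<in>A. (z - a) ^ m a) * k z"
    and k: "k holomorphic_on ball 0 1" "\<And>z. z \<in> ball 0 1 \<Longrightarrow> k z \<noteq> 0"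
    and A: "finite A" "A \<subseteq> ball c \<rho>" and sub: "cball c \<rho> \<subseteq> ball 0 1" and \<rho>: "0 < \<rho>"
  shows "((\<lambda>z. z * (deriv f z / f z)) has_contour_integral
      2 * of_real pi * \<i> * (\<Sum>a\<in>A. of_nat (m a) * a)) (circlepath c \<rho>)"
proof -
  have pim: "path_image (circlepath c \<rho>) \<subseteq> ball 0 1" using sub \<rho> by (auto simp: sphere_def)
  have "((\<lambda>z. \<Sum>a\<in>A. of_nat (m a) * (z / (z - a))) has_contour_integral
      (\<Sum>a\<in>A. of_nat (m a) * (2 * of_real pi * \<i> * a))) (circlepath c \<rho>)"
  proof (intro has_contour_integral_sum[OF A(1)] has_contour_integral_lmul)
    fix a assume "a \<in> A"
    then show "((\<lambda>z. z / (z - a)) has_contour_integral 2 * of_real pi * \<i> * a) (circlepath c \<rho>)"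
      using A(2) by (intro Cauchy_integral_circlepath_simple holomorphic_intros) (auto simp: dist_norm norm_minus_commute)
  qed
  moreover have "((\<lambda>z. z * (deriv k z / k z)) has_contour_integral 0) (circlepath c \<rho>)"
    by (rule Cauchy_theorem_convex_simple[of _ "ball 0 1"])
      (use k pim in \<open>auto intro!: holomorphic_intros holomorphic_deriv\<close>)
  ultimately have I: "((\<lambda>z. (\<Sum>a\<in>A. of_nat (m a) * (z / (z - a))) + z * (deriv k z / k z)) has_contour_integral
      (\<Sum>a\<in>A. of_nat (m a) * (2 * of_real pi * \<i> * a)) + 0) (circlepath c \<rho>)"
    by (rule has_contour_integral_add)
  have c: "(\<Sum>a\<in>A. of_nat (m a) * (2 * of_real pi * \<i> * a)) + 0 = 2 * of_real pi * \<i> * (\<Sum>a\<in>A. of_nat (m a) * a)"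
    by (simp add: sum_distrib_left mult_ac)
  show ?thesis
  proof (rule has_contour_integral_eq[OF I[unfolded c]])
    fix z assume that: "z \<in> path_image (circlepath c \<rho>)"
    have "z \<in> ball 0 1" "z \<notin> A" using that pim A(2) \<rho> by auto
    then show "(\<Sum>a\<in>A. of_nat (m a) * (z / (z - a))) + z * (deriv k z / k z) = z * (deriv f z / f z)"
      using log_deriv_factored[OF eq open_ball _ k(1) k(2) A(1)] by (simp add: distrib_left sum_distrib_left mult_ac)
  qed
qed

text \<open>
  Integration by parts: \<open>z * (f' / f - f' / (f - 1))\<close> is \<open>- z * \<phi>'\<close> for \<open>\<phi> = Ln (1 - 1 / f)\<close>, so its integral is
  the integral of \<open>\<phi>\<close>.
\<close>

lemma moment_difference_bound:
  fixes f k h :: "complex \<Rightarrow> complex"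
  assumes hol: "f holomorphic_on ball 0 1"
    and f: "\<And>z. z \<in> ball 0 1 \<Longrightarrow> f z = (\<Prod>a\<in>A. (z - a) ^ m a) * k z"
    and f1: "\<And>z. z \<in> ball 0 1 \<Longrightarrow> f z - 1 = (\<Prod>a\<in>B. (z - a) ^ l a) * h z"
    and k: "k holomorphic_on ball 0 1" "\<And>z. z \<in> ball 0 1 \<Longrightarrow> k z \<noteq> 0"
    and h: "h holomorphic_on ball 0 1" "\<And>z. z \<in> ball 0 1 \<Longrightarrow> h z \<noteq> 0"
    and A: "finite A" "A \<subseteq> ball c \<rho>" and B: "finite B" "B \<subseteq> ball c \<rho>"
    and sub: "cball c \<rho> \<subseteq> ball 0 1" and \<rho>: "0 < \<rho>"
    and \<epsilon>: "0 \<le> \<epsilon>" "\<epsilon> < 1" and small: "\<And>z. norm (z - c) = \<rho> \<Longrightarrow> f z \<noteq> 0 \<and> norm (1 / f z) \<le> \<epsilon>"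
  shows "norm ((\<Sum>a\<in>A. of_nat (m a) * a) - (\<Sum>b\<in>B. of_nat (l b) * b)) \<le> \<rho> * (\<epsilon> / (1 - \<epsilon>))"
proof -
  define \<gamma> where "\<gamma> = circlepath c \<rho>"
  define MA where "MA = (\<Sum>a\<in>A. of_nat (m a) * a)"
  define MB where "MB = (\<Sum>b\<in>B. of_nat (l b) * b)"
  have pim: "path_image \<gamma> \<subseteq> ball 0 1" using sub \<rho> by (auto simp: \<gamma>_def sphere_def)
  have on\<gamma>: "norm (z - c) = \<rho>" if "z \<in> path_image \<gamma>" for z
    using that \<rho> by (auto simp: \<gamma>_def dist_norm norm_minus_commute)
  have df: "(f has_field_derivative deriv f z) (at z)" if "z \<in> ball 0 1" for z
    using hol that by (auto intro: holomorphic_derivI)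
  define U where "U = {z \<in> ball 0 1. f z \<noteq> 0 \<and> norm (1 / f z) < 1}"
  define \<phi> where "\<phi> z = Ln (1 - 1 / f z)" for z
  define \<phi>' where "\<phi>' z = inverse (1 - 1 / f z) * (deriv f z / (f z * f z))" for z
  have d\<phi>: "(\<phi> has_field_derivative \<phi>' z) (at z)" if "z \<in> U" for z
  proof -
    have z: "z \<in> ball 0 1" "f z \<noteq> 0" "norm (1 / f z) < 1" using that by (auto simp: U_def)
    have "0 < Re (1 - 1 / f z)" using abs_Re_le_cmod[of "1 / f z"] z(3) by simp
    then have "1 - 1 / f z \<notin> \<real>\<^sub>\<le>\<^sub>0" using complex_nonpos_Reals_iff by force
    moreover have "((\<lambda>z. 1 - 1 / f z) has_field_derivative deriv f z / (f z * f z)) (at z)"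
      using z(2) by (auto intro!: derivative_eq_intros df[OF z(1)])
    ultimately show ?thesis
      unfolding \<phi>_def[abs_def] \<phi>'_def by (intro DERIV_chain2[OF has_field_derivative_Ln])
  qed
  have \<gamma>U: "path_image \<gamma> \<subseteq> U"
    using pim small[OF on\<gamma>] \<epsilon> by (fastforce simp: U_def)
  \<comment> \<open>The integrand has the primitive \<open>z * \<phi> z\<close> on \<open>U\<close>,
    which contains the circle, so the integral vanishes although the circle may enclose zeros of
    \<open>f\<close>.\<close>
  have "((\<lambda>z. \<phi> z + z * \<phi>' z) has_contour_integral 0) \<gamma>"
  proof (rule Cauchy_theorem_primitive[of U "\<lambda>z. z * \<phi> z"])
    show "((\<lambda>z. z * \<phi> z) has_field_derivative \<phi> z + z * \<phi>' z) (at z within U)" if "z \<in> U" for z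
      using DERIV_mult[OF DERIV_ident d\<phi>[OF that]] by (simp add: mult.commute has_field_derivative_at_within)
  qed (use \<gamma>U in \<open>auto simp: \<gamma>_def\<close>)
  moreover have "((\<lambda>z. z * (deriv f z / f z) - z * (deriv (\<lambda>w. f w - 1) z / (f z - 1))) has_contour_integral
      2 * of_real pi * \<i> * MA - 2 * of_real pi * \<i> * MB) \<gamma>"
    unfolding MA_def MB_def \<gamma>_def
    by (intro has_contour_integral_diff contour_integral_log_deriv_moment[OF f k A sub \<rho>]
        contour_integral_log_deriv_moment[OF f1 h B sub \<rho>])
  ultimately have I: "((\<lambda>z. (\<phi> z + z * \<phi>' z) + (z * (deriv f z / f z) - z * (deriv (\<lambda>w. f w - 1) z / (f z - 1))))
      has_contour_integral 0 + (2 * of_real pi * \<i> * MA - 2 * of_real pi * \<i> * MB)) \<gamma>"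
    by (rule has_contour_integral_add)
  have "(\<phi> has_contour_integral 0 + (2 * of_real pi * \<i> * MA - 2 * of_real pi * \<i> * MB)) \<gamma>"
  proof (rule has_contour_integral_eq[OF I])
    fix z assume z: "z \<in> path_image \<gamma>"
    have z1: "z \<in> ball 0 1" and nz: "f z \<noteq> 0" and lt: "norm (1 / f z) < 1"
      using \<gamma>U z by (auto simp: U_def)
    have f1z: "f z - 1 \<noteq> 0" using lt by auto
    have "deriv (\<lambda>w. f w - 1) z = deriv f z"
      by (rule DERIV_imp_deriv) (use DERIV_diff[OF df[OF z1] DERIV_const[of 1]] in simp)
    moreover have "\<phi>' z = deriv f z / (f z - 1) - deriv f z / f z"
      unfolding \<phi>'_def using nz f1z by (simp add: divide_simps) (simp add: algebra_simps)
    ultimately show "\<phi> z + z * \<phi>' z + (z * (deriv f z / f z) - z * (deriv (\<lambda>w. f w - 1) z / (f z - 1))) = \<phi> z"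
      by (simp add: right_diff_distrib)
  qed
  then have "(\<phi> has_contour_integral 2 * of_real pi * \<i> * (MA - MB)) (circlepath c \<rho>)"
    by (simp add: \<gamma>_def right_diff_distrib)
  then have "norm (2 * of_real pi * \<i> * (MA - MB)) \<le> (\<epsilon> / (1 - \<epsilon>)) * (2 * pi * \<rho>)"
  proof (rule has_contour_integral_bound_circlepath)
    show "norm (\<phi> z) \<le> \<epsilon> / (1 - \<epsilon>)" if "norm (z - c) = \<rho>" for z
    proof -
      define w where "w = - (1 / f z)"
      have w: "norm w \<le> \<epsilon>" "norm w < 1" using small[OF that] \<epsilon> by (auto simp: w_def)
      have "norm (\<phi> z) = norm (Ln (1 + w))" by (simp add: \<phi>_def w_def)
      also have "\<dots> \<le> norm (Ln (1 + w) - w) + norm w" by (metis diff_add_cancel norm_triangle_ineq)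
      also have "\<dots> \<le> (norm w)\<^sup>2 / (1 - norm w) + norm w" using Ln_approx_linear[OF w(2)] by simp
      also have "\<dots> = norm w / (1 - norm w)" using w by (simp add: field_simps power2_eq_square)
      also have "\<dots> \<le> \<epsilon> / (1 - \<epsilon>)" using w \<epsilon> by (intro frac_le) auto
      finally show ?thesis .
    qed
  qed (use \<rho> \<epsilon> in auto)
  moreover have "norm (2 * of_real pi * \<i> * (MA - MB)) = norm (MA - MB) * (2 * pi)"
    unfolding norm_mult by simp
  ultimately have "norm (MA - MB) * (2 * pi) \<le> \<rho> * (\<epsilon> / (1 - \<epsilon>)) * (2 * pi)"
    by (simp only: mult_ac)
  then show ?thesis unfolding MA_def MB_def by (rule mult_right_le_imp_le) simp
qed

section \<open>Quantitative estimates\<close>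

text \<open>Squaring leads to the integer exponent \<open>7\<close>; \<open>1111\<close> and
  \<open>1041\<close> are \<open>(100/3) ^ 2\<close> rounded down and \<open>(1000/31) ^ 2\<close>
  rounded up.\<close>

lemma exp_minus_7_2_bounds: "3/100 \<le> exp (- 7/2 :: real)" "exp (- 7/2 :: real) \<le> 31/1000"
proof -
  have sq: "(exp (- 7/2 :: real))\<^sup>2 = inverse (exp 7)"
    using exp_double[of "- 7/2 :: real"] by (simp add: exp_minus)
  have "exp 7 \<le> (1111 :: real)" using exp_of_nat_bounds(1)[of 7] by (simp add: power_divide)
  then have "inverse 1111 \<le> inverse (exp (7::real))" by (intro le_imp_inverse_le) auto
  then have "(3/100)\<^sup>2 \<le> (exp (- 7/2 :: real))\<^sup>2" unfolding sq by (simp add: power2_eq_square)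
  then show "3/100 \<le> exp (- 7/2 :: real)" by (rule power2_le_imp_le) simp
  have "(1041 :: real) \<le> exp 7" using exp_of_nat_bounds(2)[of 7] by (simp add: power_divide)
  then have "inverse (exp (7::real)) \<le> inverse 1041" by (intro le_imp_inverse_le) auto
  then have "(exp (- 7/2 :: real))\<^sup>2 \<le> (31/1000)\<^sup>2" unfolding sq by (simp add: power2_eq_square)
  then show "exp (- 7/2 :: real) \<le> 31/1000" by (rule power2_le_imp_le) simp
qed

text \<open>This ties the constant of the theorem to the strip width \<open>21/2\<close>: if
  \<open>r < 24/10^6\<close>, the annulus used in \<open>Schottky_on_circle\<close> contains no
  zeros or \<open>1\<close>-points. The integer \<open>1736111111\<close> is
  \<open>(10^6/24) ^ 2\<close> rounded down.\<close>

lemma exp_minus_21_2_bound: "24/10^6 \<le> exp (- 21/2 :: real)"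
proof -
  have "(exp (- 21/2 :: real))\<^sup>2 = inverse (exp 21)"
    using exp_double[of "- 21/2 :: real"] by (simp add: exp_minus)
  moreover have "exp 21 \<le> (1736111111 :: real)" using exp_of_nat_bounds(1)[of 21] by (simp add: power_divide)
  then have "inverse 1736111111 \<le> inverse (exp (21::real))" by (intro le_imp_inverse_le) auto
  ultimately have "(24/10^6)\<^sup>2 \<le> (exp (- 21/2 :: real))\<^sup>2" by (simp add: power2_eq_square)
  then show ?thesis by (rule power2_le_imp_le) simp
qed

text \<open>Otherwise \<open>norm f \<le> exp 12\<close> on the whole circle. Dividing out the zeros
  and applying the maximum principle to \<open>k\<close> gives
  \<open>1 = norm (f b) \<le> exp 12 * (2 * r / (R - r)) ^ n\<close>, which fails for
  \<open>n \<ge> 2\<close>.\<close>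

lemma large_on_circle:
  fixes f k :: "complex \<Rightarrow> complex"
  assumes hol: "f holomorphic_on ball 0 1" and k: "k holomorphic_on ball 0 1"
    and f: "\<And>z. z \<in> ball 0 1 \<Longrightarrow> f z = (\<Prod>a\<in>A. (z - a) ^ m a) * k z"
    and A: "\<And>a. a \<in> A \<Longrightarrow> norm a \<le> r" "2 \<le> (\<Sum>a\<in>A. m a)"
    and b: "norm b \<le> r" "f b = 1" and r: "0 < r" "r < 24/10^6"
    and om: "\<And>z. norm z < 1 \<Longrightarrow> f z = 0 \<or> f z = 1 \<Longrightarrow> norm z \<le> r"
    and z: "norm z = exp (- 7/2)"
  shows "1 < norm (f z)"
proof (rule ccontr)
  assume "\<not> 1 < norm (f z)"
  then have le1: "norm (f z) \<le> 1" by simp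
  define R where "R = exp (- 7/2 :: real)"
  define n where "n = (\<Sum>a\<in>A. m a)"
  have R: "3/100 \<le> R" "R \<le> 31/1000" using exp_minus_7_2_bounds by (simp_all add: R_def)
  have upper: "norm (f w) \<le> exp 12" if "norm w = R" for w
  proof (rule Schottky_on_circle[OF hol _ z le1])
    show "f w \<noteq> 0 \<and> f w \<noteq> 1" if "exp (- 21/2) < norm w" "norm w < 1" for w
      using om[OF that(2)] that(1) r exp_minus_21_2_bound by fastforce
  qed (use that in \<open>simp add: R_def\<close>)
  have kR: "norm (k w) \<le> exp 12 / (R - r) ^ n" if w: "norm w = R" for w
  proof -
    have "(R - r) ^ n \<le> (\<Prod>a\<in>A. norm (w - a) ^ m a)"
      unfolding n_def
    proof (rule prod_power_ge)
      show "R - r \<le> norm (w - a)" if "a \<in> A" for a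
        using norm_triangle_ineq2[of w a] A(1)[OF that] w by simp
    qed (use R r in auto)
    then have "(R - r) ^ n * norm (k w) \<le> norm (f w)"
      using f[of w] w R by (simp add: norm_mult mult_right_mono flip: norm_power prod_norm)
    with upper[OF w] have "norm (k w) * (R - r) ^ n \<le> exp 12" by (simp add: mult.commute)
    then show ?thesis using R r by (simp add: pos_le_divide_eq)
  qed
  have kb: "norm (k b) \<le> exp 12 / (R - r) ^ n"
  proof (rule maximum_modulus_frontier[of k "cball 0 R"])
    show "k holomorphic_on interior (cball 0 R)" using k R by (auto elim!: holomorphic_on_subset)
    show "continuous_on (closure (cball 0 R)) k"
      using holomorphic_on_imp_continuous_on[OF k] R by (auto elim!: continuous_on_subset)
    show "norm (k w) \<le> exp 12 / (R - r) ^ n" if "w \<in> frontier (cball 0 R)" for w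
      using kR[of w] that R by simp
  qed (use b R r in auto)
  have prod_b: "(\<Prod>a\<in>A. norm (b - a) ^ m a) \<le> (2 * r) ^ n"
    unfolding n_def
  proof (rule prod_power_le)
    show "norm (b - a) \<le> 2 * r" if "a \<in> A" for a
      using norm_triangle_ineq4[of b a] A(1)[OF that] b(1) by simp
  qed auto
  have one: "1 = (\<Prod>a\<in>A. norm (b - a) ^ m a) * norm (k b)"
    using arg_cong[OF f[of b], of norm] b r by (simp add: norm_mult flip: norm_power prod_norm)
  have "1 \<le> (2 * r) ^ n * (exp 12 / (R - r) ^ n)"
    unfolding one by (rule mult_mono[OF prod_b kb]) (use r in auto)
  then have "((R - r) / (2 * r)) ^ n \<le> exp 12"
    using R r by (simp add: power_divide divide_simps mult.commute)
  moreover have "624 \<le> (R - r) / (2 * r)" using R r by (simp add: pos_le_divide_eq)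
  then have "624 ^ n \<le> ((R - r) / (2 * r)) ^ n" by (intro power_mono) auto
  \<comment> \<open>The assumption of at least two zeros enters here: \<open>624 ^ 2\<close> exceeds
    \<open>exp 12\<close>, whereas \<open>624\<close> alone does not.\<close>
  moreover have "(624 :: real) ^ 2 \<le> 624 ^ n" using A(2) by (intro power_increasing) (auto simp: n_def)
  moreover have "exp 12 \<le> (200000 :: real)" using exp_of_nat_bounds(1)[of 12] by (simp add: power_divide)
  ultimately show False by simp
qed

text \<open>At \<open>b\<close> the value \<open>1\<close> is reached although the product over
  zeros is tiny, so \<open>1 / k\<close> is at most \<open>(2 * r) ^ n\<close> there. Harnack's
  inequality spreads this to the circle with exponent \<open>3/4\<close>, giving order
  \<open>r powr (3 * n / 4)\<close>; for \<open>n \<ge> 2\<close> this is small enough.\<close>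

lemma reciprocal_small_near_one_point:
  fixes f k :: "complex \<Rightarrow> complex"
  assumes k: "k holomorphic_on ball 0 1" "\<And>z. z \<in> ball 0 1 \<Longrightarrow> k z \<noteq> 0"
    and f: "\<And>z. z \<in> ball 0 1 \<Longrightarrow> f z = (\<Prod>a\<in>A. (z - a) ^ m a) * k z"
    and A: "\<And>a. a \<in> A \<Longrightarrow> norm a \<le> r" "2 \<le> (\<Sum>a\<in>A. m a)"
    and b: "norm b \<le> r" "f b = 1" and r: "0 < r" "r < 24/10^6"
    and large: "\<And>z. norm z = exp (- 7/2) \<Longrightarrow> 1 < norm (f z)"
    and z: "norm (z - b) = 1/250"
  shows "f z \<noteq> 0 \<and> norm (1 / f z) \<le> 160 * r"
proof -
  define R where "R = exp (- 7/2 :: real)"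
  \<comment> \<open>Slightly above \<open>R + r\<close>, which is below \<open>0.031024\<close>;
    this makes \<open>Re (G w)\<close> strictly negative.\<close>
  define D where "D = (311/10000 :: real)"
  define n where "n = (\<Sum>a\<in>A. m a)"
  have R: "3/100 \<le> R" "R \<le> 31/1000" using exp_minus_7_2_bounds by (simp_all add: R_def)
  have n: "2 \<le> n" using A by (simp add: n_def)
  \<comment> \<open>As \<open>k\<close> has no zeros, the maximum principle applies to
    \<open>1 / k\<close>; on the circle of radius \<open>R\<close> the hypothesis
    \<open>large\<close> bounds it.\<close>
  have k_inv: "norm (1 / k w) \<le> (R + r) ^ n" if "norm w \<le> R" for w
  proof (rule maximum_modulus_frontier[of "\<lambda>w. 1 / k w" "cball 0 R"])
    show "(\<lambda>w. 1 / k w) holomorphic_on interior (cball 0 R)"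
      using k R by (auto intro!: holomorphic_intros elim!: holomorphic_on_subset)
    show "continuous_on (closure (cball 0 R)) (\<lambda>w. 1 / k w)"
      using holomorphic_on_imp_continuous_on[OF k(1)] k(2) R
      by (auto intro!: continuous_intros elim!: continuous_on_subset)
    show "norm (1 / k w) \<le> (R + r) ^ n" if "w \<in> frontier (cball 0 R)" for w
    proof -
      have w: "norm w = R" using that R by simp
      have "(\<Prod>a\<in>A. norm (w - a) ^ m a) \<le> (R + r) ^ n"
        unfolding n_def
      proof (rule prod_power_le)
        show "norm (w - a) \<le> R + r" if "a \<in> A" for a
          using norm_triangle_ineq4[of w a] A(1)[OF that] w by simp
      qed auto
      then have "norm (f w) \<le> (R + r) ^ n * norm (k w)"
        using f[of w] w R by (simp add: norm_mult mult_right_mono flip: norm_power prod_norm)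
      with large[of w] w have "1 \<le> (R + r) ^ n * norm (k w)" by (simp add: R_def)
      then show ?thesis using k(2)[of w] w R by (simp add: norm_divide pos_divide_le_eq)
    qed
  qed (use that in auto)
  obtain g where holg: "g holomorphic_on ball 0 1" and g: "\<And>w. w \<in> ball 0 1 \<Longrightarrow> k w = exp (g w)"
    using contractible_imp_holomorphic_log[OF k(1) convex_imp_contractible[OF convex_ball] k(2)] by metis
  define G where "G w = - g w - of_real (n * ln D)" for w
  have D: "0 < D" "R + r < D" using R r by (simp_all add: D_def)
  have Re_G: "exp (Re (G w)) = norm (1 / k w) / D ^ n" if "w \<in> ball 0 1" for w
    using g[OF that] D by (simp add: G_def norm_divide exp_diff exp_minus divide_inverse exp_of_nat_mult norm_inverse mult.commute)
  have near: "norm w < R \<and> w \<in> ball 0 1" if "w \<in> ball b (7/250)" for w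
  proof -
    have "norm w \<le> norm (w - b) + norm b" by (metis diff_add_cancel norm_triangle_ineq)
    then show ?thesis using that b R r by (simp add: dist_norm norm_minus_commute)
  qed
  \<comment> \<open>The circle of radius \<open>1/250\<close> has relative radius \<open>1/7\<close> in a disc around \<open>b\<close> of radius \<open>7/250 < R - r\<close>.\<close>
  have "Re (G z) \<le> (1 - 1/7) / (1 + 1/7) * Re (G b)"
  proof (rule Harnack_left_half_plane[where G = G and b = b and z = z and \<rho> = "7/250" and t = "1/7"])
    show "G holomorphic_on ball b (7/250)"
      unfolding G_def using near by (intro holomorphic_intros holomorphic_on_subset[OF holg]) auto
    show "Re (G w) < 0" if "w \<in> ball b (7/250)" for w
    proof -
      have "norm (1 / k w) \<le> (R + r) ^ n" using near[OF that] by (intro k_inv) auto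
      also have "\<dots> < D ^ n" using D R r n by (intro power_strict_mono) auto
      finally have "exp (Re (G w)) < 1" using near[OF that] D by (simp add: Re_G)
      then show ?thesis by simp
    qed
  qed (use z in auto)
  then have ReGz: "Re (G z) \<le> 3/4 * Re (G b)" by simp
  have b1: "b \<in> ball 0 1" and z1: "z \<in> ball 0 1"
    using near[of b] near[of z] z by (auto simp: dist_norm norm_minus_commute)
  have prod_b: "(\<Prod>a\<in>A. norm (b - a) ^ m a) \<le> (2 * r) ^ n"
    unfolding n_def
  proof (rule prod_power_le)
    show "norm (b - a) \<le> 2 * r" if "a \<in> A" for a
      using norm_triangle_ineq4[of b a] A(1)[OF that] b(1) by simp
  qed auto
  have one: "1 = (\<Prod>a\<in>A. norm (b - a) ^ m a) * norm (k b)"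
    using arg_cong[OF f[OF b1], of norm] b by (simp add: norm_mult flip: norm_power prod_norm)
  have "1 \<le> (2 * r) ^ n * norm (k b)"
    unfolding one by (rule mult_right_mono[OF prod_b]) simp
  then have "norm (1 / k b) \<le> (2 * r) ^ n"
    using k(2)[OF b1] by (simp add: norm_divide pos_divide_le_eq)
  then have "exp (Re (G b)) \<le> (2 * r / D) ^ n"
    using D by (simp add: Re_G[OF b1] power_divide divide_right_mono)
  then have "Re (G b) \<le> n * ln (2 * r / D)"
    using D r by (metis exp_le_cancel_iff exp_ln exp_of_nat_mult divide_pos_pos mult_pos_pos zero_less_numeral)
  with ReGz have "Re (G z) \<le> n * (3/4 * ln (2 * r / D))" by (simp add: algebra_simps)
  then have "exp (Re (G z)) \<le> exp (3/4 * ln (2 * r / D)) ^ n"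
    by (simp flip: exp_of_nat_mult)
  then have kz: "norm (1 / k z) \<le> (D * exp (3/4 * ln (2 * r / D))) ^ n"
    using D by (simp add: Re_G[OF z1] power_mult_distrib pos_divide_le_eq mult.commute)
  \<comment> \<open>This is \<open>1/250 - 2 * 24/10^6\<close>, a lower bound for the distance from
    \<open>z\<close> to any zero.\<close>
  define d where "d = (3952/1000000 :: real)"
  have "d ^ n \<le> (\<Prod>a\<in>A. norm (z - a) ^ m a)"
    unfolding n_def
  proof (rule prod_power_ge)
    show "d \<le> norm (z - a)" if "a \<in> A" for a
    proof -
      have "norm (z - b) \<le> norm (z - a) + norm (a - b)" using norm_triangle_ineq[of "z - a" "a - b"] by simp
      moreover have "norm (a - b) \<le> 2 * r" using norm_triangle_ineq4[of a b] A(1)[OF that] b(1) by simp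
      ultimately show ?thesis using z r by (simp add: d_def)
    qed
  qed (auto simp: d_def)
  then have fz: "d ^ n * norm (k z) \<le> norm (f z)"
    using f[OF z1] by (simp add: norm_mult mult_right_mono flip: norm_power prod_norm)
  have kz0: "0 < norm (k z)" using k(2)[OF z1] by simp
  have dn: "0 < d ^ n" by (simp add: d_def)
  have fz0: "0 < norm (f z)" using fz mult_pos_pos[OF dn kz0] by linarith
  define Q where "Q = D * exp (3/4 * ln (2 * r / D)) / d"
  have "norm (1 / f z) \<le> 1 / (d ^ n * norm (k z))"
    using fz fz0 mult_pos_pos[OF dn kz0] by (simp add: norm_divide frac_le)
  also have "\<dots> = norm (1 / k z) / d ^ n" by (simp add: norm_divide)
  also have "\<dots> \<le> Q ^ n" using kz dn by (simp add: Q_def power_divide divide_right_mono)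
  finally have fQ: "norm (1 / f z) \<le> Q ^ n" .
  have Q0: "0 \<le> Q" using D by (simp add: Q_def d_def)
  have Q2: "Q\<^sup>2 \<le> 160 * r"
  proof -
    have x: "0 < 2 * r / D" using D r by simp
    have "(exp (3/4 * ln (2 * r / D)))\<^sup>2 = exp (ln (2 * r / D) + ln (2 * r / D) / 2)"
      using exp_double[of "3/4 * ln (2 * r / D)"] by (simp add: field_simps)
    also have "\<dots> = 2 * r / D * sqrt (2 * r / D)"
      using x by (simp add: exp_add flip: ln_sqrt)
    finally have e: "(exp (3/4 * ln (2 * r / D)))\<^sup>2 = 2 * r / D * sqrt (2 * r / D)" .
    \<comment> \<open>Only half a power of \<open>r\<close> is estimated numerically; the remaining
      full power gives the linear bound \<open>160 * r\<close>.\<close>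
    have "sqrt (2 * r / D) \<le> 4/100"
      by (rule real_le_lsqrt) (use r in \<open>auto simp: D_def power2_eq_square\<close>)
    then have x4: "2 * r / D * sqrt (2 * r / D) \<le> 2 * r / D * (4/100)"
      using x by (intro mult_left_mono) auto
    have "Q\<^sup>2 \<le> D\<^sup>2 * (2 * r / D * (4/100)) / d\<^sup>2"
      unfolding Q_def power_divide power_mult_distrib e
      by (intro divide_right_mono mult_left_mono x4) auto
    also have "\<dots> \<le> 160 * r" using r by (simp add: D_def d_def power2_eq_square)
    finally show ?thesis .
  qed
  then have "Q\<^sup>2 \<le> 1\<^sup>2" using r by simp
  then have "Q \<le> 1" by (rule power2_le_imp_le) simp
  then have "Q ^ n \<le> Q\<^sup>2" using Q0 n by (intro power_decreasing)
  with Q2 fQ fz0 show ?thesis by auto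
qed

section \<open>Contradiction from comparing moments\<close>

text \<open>All terms \<open>m a * a\<close> and \<open>- l b * b\<close> are nonnegative and one of
  them is at least \<open>s\<close>, while the contour estimate makes their sum smaller than
  \<open>s\<close>.\<close>

lemma no_double_zero_in_small_disc:
  fixes f :: "complex \<Rightarrow> complex"
  assumes hol: "f holomorphic_on ball 0 1" and r: "0 < r" "r < 24/10^6"
    and zeros: "{z \<in> ball 0 1. f z = 0} \<subseteq> complex_of_real ` {0..r}"
    and ones: "{z \<in> ball 0 1. f z = 1} \<subseteq> complex_of_real ` {-r..0}"
    and one: "\<exists>z\<in>ball 0 1. f z = 1"
    and two: "takes_value_at_least 2 f (ball 0 1) 0"
  shows False
proof -
  define A where "A = {z \<in> ball 0 1. f z = 0}"
  define B where "B = {z \<in> ball 0 1. f z - 1 = 0}"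
  have A_sub: "A \<subseteq> complex_of_real ` {0..r}" and B_sub: "B \<subseteq> complex_of_real ` {-r..0}"
    using zeros ones by (auto simp: A_def B_def)
  obtain A' where A': "finite A'" "A' \<subseteq> A" "2 \<le> (\<Sum>z\<in>A'. zorder f z)"
    using two by (auto simp: takes_value_at_least_def A_def)
  have "A' \<noteq> {}" using A'(3) by auto
  then obtain a0 where a0: "a0 \<in> A" using A' by auto
  obtain b0 where b0: "b0 \<in> B" using one by (auto simp: B_def)
  have nonconst: "\<not> g constant_on ball 0 1" if "g = f \<or> g = (\<lambda>z. f z - 1)" for g
  proof
    assume "g constant_on ball 0 1"
    then have "g a0 = g b0" using a0 b0 unfolding constant_on_def A_def B_def by fastforce
    then show False using a0 b0 that by (auto simp: A_def B_def)
  qed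
  have compact_zeros: "finite {z \<in> ball 0 1. g z = 0}"
    if g: "g = f \<or> g = (\<lambda>z. f z - 1)" and sub: "{z \<in> ball 0 1. g z = 0} \<subseteq> cball 0 r" for g
  proof -
    have "finite {z \<in> cball 0 r. g z = 0}"
      by (rule holomorphic_compact_finite_zeros[of g "ball 0 1"])
        (use hol nonconst[OF g] r g in \<open>auto intro!: holomorphic_intros\<close>)
    then show ?thesis by (rule finite_subset[rotated]) (use sub in auto)
  qed
  have finA: "finite A" unfolding A_def by (rule compact_zeros) (use A_sub in \<open>auto simp: A_def\<close>)
  have finB: "finite B" unfolding B_def
    by (rule compact_zeros) (use B_sub in \<open>auto simp: B_def\<close>)
  have f_nz: "\<exists>z\<in>ball 0 1. f z \<noteq> 0" and f1_nz: "\<exists>z\<in>ball 0 1. f z - 1 \<noteq> 0"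
    using a0 b0 by (force simp: A_def B_def)+
  have hol1: "(\<lambda>z. f z - 1) holomorphic_on ball 0 1" by (intro holomorphic_intros hol)
  obtain m k where k: "k holomorphic_on ball 0 1" "\<And>z. z \<in> ball 0 1 \<Longrightarrow> k z \<noteq> 0"
    and f: "\<And>z. z \<in> ball 0 1 \<Longrightarrow> f z = (\<Prod>a\<in>A. (z - a) ^ m a) * k z"
    and m: "\<And>a. a \<in> A \<Longrightarrow> zorder f a = int (m a) \<and> 0 < m a"
    by (rule holomorphic_factor_zeros[OF hol open_ball connected_ball A_def finA f_nz]) (rule that; assumption)
  obtain l h where h: "h holomorphic_on ball 0 1" "\<And>z. z \<in> ball 0 1 \<Longrightarrow> h z \<noteq> 0"
    and f1: "\<And>z. z \<in> ball 0 1 \<Longrightarrow> f z - 1 = (\<Prod>b\<in>B. (z - b) ^ l b) * h z"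
    and l: "\<And>b. b \<in> B \<Longrightarrow> zorder (\<lambda>z. f z - 1) b = int (l b) \<and> 0 < l b"
    by (rule holomorphic_factor_zeros[OF hol1 open_ball connected_ball B_def finB f1_nz]) (rule that; assumption)
  have mult: "2 \<le> (\<Sum>a\<in>A. m a)"
  proof -
    have "2 \<le> (\<Sum>z\<in>A'. int (m z))" using A'(2,3) m by (metis (no_types, lifting) subsetD sum.cong)
    also have "\<dots> \<le> (\<Sum>z\<in>A. int (m z))" using A' finA by (intro sum_mono2) auto
    finally show ?thesis by (simp flip: of_nat_sum)
  qed
  \<comment> \<open>The final contradiction needs a radius that is attained by a zero or a \<open>1\<close>-point.\<close>
  define s where "s = Max (norm ` (A \<union> B))"
  have s_ge: "norm z \<le> s" if "z \<in> A \<union> B" for z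
    unfolding s_def using finA finB that by (intro Max_ge) auto
  have "s \<in> norm ` (A \<union> B)" unfolding s_def using finA finB a0 by (intro Max_in) auto
  then obtain x where x: "x \<in> A \<union> B" "norm x = s" by auto
  have "norm x \<le> r" using x A_sub B_sub by auto
  with x r have s_lt: "s < 24/10^6" by simp
  \<comment> \<open>If \<open>s\<close> were \<open>0\<close>, the zero \<open>a0\<close> and the
    \<open>1\<close>-point \<open>b0\<close> would both be the origin.\<close>
  have s0: "0 < s"
  proof (rule ccontr)
    assume "\<not> 0 < s"
    then have "norm a0 \<le> 0" "norm b0 \<le> 0" using s_ge[OF UnI1[OF a0]] s_ge[OF UnI2[OF b0]] by linarith+
    then show False using a0 b0 by (auto simp: A_def B_def)
  qed
  have b0': "norm b0 \<le> s" "f b0 = 1" using b0 s_ge by (auto simp: B_def)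
  have As: "norm a \<le> s" if "a \<in> A" for a using that s_ge by auto
  have om: "norm z \<le> s" if "norm z < 1" "f z = 0 \<or> f z = 1" for z
    using that by (intro s_ge) (auto simp: A_def B_def)
  have large: "1 < norm (f z)" if "norm z = exp (- 7/2)" for z
    by (rule large_on_circle[OF hol k(1) f As mult b0' s0 s_lt om that])
  have small: "f z \<noteq> 0 \<and> norm (1 / f z) \<le> 160 * s" if "norm (z - b0) = 1/250" for z
    by (rule reciprocal_small_near_one_point[OF k f As mult b0' s0 s_lt large that])
  have in_ball: "z \<in> ball b0 (1/250)" if "z \<in> A \<union> B" for z
    using norm_triangle_ineq4[of b0 z] s_ge[OF that] b0' s_lt by (simp add: dist_norm)
  have "cball b0 (1/250) \<subseteq> ball 0 1"
  proof
    fix z assume "z \<in> cball b0 (1/250)"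
    then have "norm (z - b0) \<le> 1/250" by (simp add: dist_norm norm_minus_commute)
    moreover have "norm z \<le> norm (z - b0) + norm b0" by (metis diff_add_cancel norm_triangle_ineq)
    ultimately show "z \<in> ball 0 1" using b0' s_lt by simp
  qed
  then have bound: "norm ((\<Sum>a\<in>A. of_nat (m a) * a) - (\<Sum>b\<in>B. of_nat (l b) * b))
      \<le> 1/250 * (160 * s / (1 - 160 * s))"
    by (intro moment_difference_bound[OF hol f f1 k h finA _ finB _ _ _ _ _ small])
      (use in_ball s0 s_lt in auto)
  \<comment> \<open>The factor \<open>160/250\<close> is well below \<open>1\<close>, and
    \<open>160 * s < 0.00384\<close> barely changes the denominator.\<close>
  have "1/250 * (160 * s / (1 - 160 * s)) < s"
    using s0 s_lt by (simp add: field_simps)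
  moreover have "s \<le> Re ((\<Sum>a\<in>A. of_nat (m a) * a) - (\<Sum>b\<in>B. of_nat (l b) * b))"
  proof -
    have Re: "Re ((\<Sum>a\<in>A. of_nat (m a) * a) - (\<Sum>b\<in>B. of_nat (l b) * b))
        = (\<Sum>a\<in>A. m a * Re a) + (\<Sum>b\<in>B. l b * (- Re b))"
      by (simp add: sum_negf)
    have ReA: "norm a = Re a" "0 \<le> m a * Re a" if "a \<in> A" for a using that A_sub by auto
    have ReB: "norm b = - Re b" "0 \<le> l b * (- Re b)" if "b \<in> B" for b
      using that B_sub by (auto simp: mult_nonneg_nonpos)
    have "0 \<le> (\<Sum>a\<in>A. m a * Re a)" "0 \<le> (\<Sum>b\<in>B. l b * (- Re b))"
      by (intro sum_nonneg ReA ReB; assumption)+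
    moreover have "s \<le> (\<Sum>a\<in>A. m a * Re a)" if "x \<in> A"
    proof -
      have "1 * s \<le> m x * Re x" using m[OF that] ReA(1)[OF that] x s0 by (intro mult_mono) auto
      also have "\<dots> \<le> (\<Sum>a\<in>A. m a * Re a)" by (rule member_le_sum[OF that]) (use ReA(2) finA in auto)
      finally show ?thesis by simp
    qed
    moreover have "s \<le> (\<Sum>b\<in>B. l b * (- Re b))" if "x \<in> B"
    proof -
      have "1 * s \<le> l x * (- Re x)" using l[OF that] ReB(1)[OF that] x s0 by (intro mult_mono) auto
      also have "\<dots> \<le> (\<Sum>b\<in>B. l b * (- Re b))" by (rule member_le_sum[OF that]) (use ReB(2) finB in auto)
      finally show ?thesis by simp
    qed
    ultimately show ?thesis unfolding Re using x(1) by fastforce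
  qed
  ultimately show False
    using bound complex_Re_le_cmod[of "(\<Sum>a\<in>A. of_nat (m a) * a) - (\<Sum>b\<in>B. of_nat (l b) * b)"]
    by linarith
qed

section \<open>Reflection and the final bound\<close>

text \<open>Orders are unchanged by the factor \<open>-1\<close> and by the substitution of
  \<open>- w\<close> for \<open>w\<close>; \<open>nz\<close> excludes the constant \<open>1\<close>,
  for which \<open>zorder\<close> would not be a multiplicity.\<close>

lemma takes_value_at_least_reflect:
  fixes f :: "complex \<Rightarrow> complex"
  assumes hol: "f holomorphic_on ball 0 1" and nz: "\<exists>z\<in>ball 0 1. f z \<noteq> 1"
    and t: "takes_value_at_least n f (ball 0 1) 1"
  shows "takes_value_at_least n (\<lambda>z. 1 - f (- z)) (ball 0 1) 0"
proof -
  obtain A where A: "finite A" "A \<subseteq> {z \<in> ball 0 1. f z = 1}" "int n \<le> (\<Sum>z\<in>A. zorder (\<lambda>w. f w - 1) z)"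
    using t by (auto simp: takes_value_at_least_def)
  have "zorder (\<lambda>w. 1 - f (- w)) (- z) = zorder (\<lambda>w. f w - 1) z" if "z \<in> A" for z
  proof -
    have z: "z \<in> ball 0 1" using that A by auto
    have hol1: "(\<lambda>w. f w - 1) holomorphic_on ball 0 1" by (intro holomorphic_intros hol)
    then have an: "(\<lambda>w. f w - 1) analytic_on {z}"
      using z by (meson analytic_at open_ball)
    obtain \<beta> where "\<beta> \<in> ball 0 1" "f \<beta> - 1 \<noteq> 0" using nz by auto
    from non_zero_neighbour_alt[OF hol1 open_ball connected_ball z this]
    have ev: "eventually (\<lambda>w. f w - 1 \<noteq> 0) (at z)" by (rule eventually_mono) simp
    have "zorder (\<lambda>w. 1 - f (- w)) (- z) = zorder (\<lambda>w. - (f (- w) - 1)) (- z)" by simp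
    also have "\<dots> = zorder (\<lambda>w. f (- w) - 1) (- z)" using zorder_cmult[of "-1" "\<lambda>w. f (- w) - 1" "- z"] by simp
    also have "\<dots> = zorder (\<lambda>w. f (- 1 * w) - 1) (- z)" by simp
    also have "\<dots> = zorder (\<lambda>w. f w - 1) (- 1 * (- z))"
      by (rule zorder_scale[where f = "\<lambda>w. f w - 1"]) (use analytic_on_imp_meromorphic_on[OF an] an ev in auto)
    finally show ?thesis by simp
  qed
  then have "(\<Sum>z\<in>uminus ` A. zorder (\<lambda>w. 1 - f (- w)) z) = (\<Sum>z\<in>A. zorder (\<lambda>w. f w - 1) z)"
    by (simp add: sum.reindex)
  then show ?thesis
    unfolding takes_value_at_least_def using A by (intro exI[of _ "uminus ` A"]) auto
qed

lemma radius_bound_small: "radius_bound (24/10^6)"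
  unfolding radius_bound_def
proof (intro allI impI, rule ccontr)
  fix f :: "complex \<Rightarrow> complex" and r :: real
  assume hol: "f holomorphic_on ball 0 1" and r: "0 < r" "r < 1"
    and zeros: "{z \<in> ball 0 1. f z = 0} \<subseteq> complex_of_real ` {0..r}"
    and ones: "{z \<in> ball 0 1. f z = 1} \<subseteq> complex_of_real ` {-r..0}"
    and zero: "\<exists>z\<in>ball 0 1. f z = 0" and one: "\<exists>z\<in>ball 0 1. f z = 1"
    and two: "takes_value_at_least 2 f (ball 0 1) 0 \<or> takes_value_at_least 2 f (ball 0 1) 1"
    and "\<not> 24/10^6 \<le> r"
  then have lt: "r < 24/10^6" by simp
  from two show False
  proof
    assume "takes_value_at_least 2 f (ball 0 1) 0"
    then show False by (rule no_double_zero_in_small_disc[OF hol r(1) lt zeros ones one])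
  next
    assume t: "takes_value_at_least 2 f (ball 0 1) 1"
    \<comment> \<open>Exchanges zeros with \<open>1\<close>-points, and the sign change puts each
      set back into the interval required of it.\<close>
    define g where "g z = 1 - f (- z)" for z
    have neg: "- z \<in> complex_of_real ` S \<Longrightarrow> z \<in> complex_of_real ` (uminus ` S)" for z S
      by (metis (no_types, lifting) add.inverse_inverse imageE imageI of_real_minus)
    show False
    proof (rule no_double_zero_in_small_disc[OF _ r(1) lt, of g])
      show "g holomorphic_on ball 0 1"
        unfolding g_def by (intro holomorphic_intros holomorphic_on_compose_gen[OF _ hol, unfolded o_def]) auto
      show "{z \<in> ball 0 1. g z = 0} \<subseteq> complex_of_real ` {0..r}"
      proof
        fix z assume "z \<in> {z \<in> ball 0 1. g z = 0}"
        then have "- z \<in> {z \<in> ball 0 1. f z = 1}" by (simp add: g_def)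
        then have "z \<in> complex_of_real ` (uminus ` {-r..0})" using ones neg by blast
        then show "z \<in> complex_of_real ` {0..r}" by simp
      qed
      show "{z \<in> ball 0 1. g z = 1} \<subseteq> complex_of_real ` {-r..0}"
      proof
        fix z assume "z \<in> {z \<in> ball 0 1. g z = 1}"
        then have "- z \<in> {z \<in> ball 0 1. f z = 0}" by (simp add: g_def)
        then have "z \<in> complex_of_real ` (uminus ` {0..r})" using zeros neg by blast
        then show "z \<in> complex_of_real ` {-r..0}" by simp
      qed
      obtain w where "w \<in> ball 0 1" "f w = 0" using zero by auto
      then show "\<exists>z\<in>ball 0 1. g z = 1" by (intro bexI[of _ "- w"]) (auto simp: g_def)
      have "\<exists>z\<in>ball 0 1. f z \<noteq> 1" using zero by force
      then show "takes_value_at_least 2 g (ball 0 1) 0"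
        unfolding g_def[abs_def] by (rule takes_value_at_least_reflect[OF hol _ t])
    qed
  qed
qed

theorem theorem1p4:
  "(\<exists>C>0. radius_bound C) \<and> radius_bound 0.000024"
proof -
  have "radius_bound 0.000024" using radius_bound_small by simp
  then show ?thesis by (intro conjI exI[of _ "0.000024"]) auto
qed

end
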